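(* Assume the following hypothesis (a form of the Hardy–Littlewood prime pair conjecture): uniformly for integers $2\le d\le \frac89 x$, $$G(x,d)=\mathfrak{S}(d)\int_2^{x-d}\frac{dt}{\log t\,\log(t+d)}+E(x,d),\qquad E(x,d)=o\!\left(\frac{x}{(\log x)^4}\right)\ \text{as } x\to\infty.$$ Let $0<\delta\le \frac14$ be given. Then for all sufficiently large $x$ the following holds. If the interval $\left[(1+\frac{\delta}{2})\frac{x}{(\log x)^2},\,(1-\frac{\delta}{2})\frac{x}{\log x}\right]$ contains a primorial, then that primorial is the prime difference champion for $x$. If this interval does not contain a primorial, then each of the intervals $\left[(1-\delta)\frac{x}{(\log x)^2},\,(1+\frac{\delta}{2})\frac{x}{(\log x)^2}\right)$ and $\left((1-\frac{\delta}{2})\frac{x}{\log x},\,(1+\delta)\frac{x}{\log x}\right]$ contains a primorial, and the prime difference champion(s) for $x$ are one or the other, or sometimes both, of these primorials.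
   Context: For $x\ge 2$ and a positive integer $d$, let $G(x,d)$ be the number of pairs of primes $(p,p')$ with $p,p'\le x$ and $p'-p=d$. A prime difference champion (PDC) for $x$ is any positive integer $d$ at which $G(x,d)$ attains its maximum over positive integers $d$; the set of these is $D^*(x)$. The singular series is $\mathfrak{S}(d)=2C_2\prod_{p\mid d,\,p>2}\frac{p-1}{p-2}$ for even $d\neq 0$ and $\mathfrak{S}(d)=0$ for odd $d$, where $C_2=\prod_{p>2}\left(1-\frac{1}{(p-1)^2}\right)$. With $p_j$ the $j$-th prime, the $k$-th primorial is $p_k^\sharp=\prod_{j=1}^k p_j$; a primorial is any $p_k^\sharp$, $k\ge1$. *)

theory Defs
  imports "HOL-Analysis.Analysis" "HOL-Computational_Algebra.Primes"
begin

definition prime_pair_count :: "real \<Rightarrow> nat \<Rightarrow> nat" where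
  "prime_pair_count x d =
     card {(p, p'). prime p \<and> prime p' \<and> real p \<le> x \<and> real p' \<le> x \<and> p' = p + d}"

definition prime_difference_champions :: "real \<Rightarrow> nat set" where
  "prime_difference_champions x =
     {d. d > 0 \<and> (\<forall>d'>0. prime_pair_count x d' \<le> prime_pair_count x d)}"

definition twin_prime_const :: real where
  "twin_prime_const = (\<Prod>n. if prime n \<and> n > 2 then 1 - 1 / (real n - 1)\<^sup>2 else 1)"

text \<open>Only positive arguments are meaningful; the value at 0 is a junk value.\<close>

definition singular_series :: "nat \<Rightarrow> real" where
  "singular_series d =
     (if even d
      then 2 * twin_prime_const *
        (\<Prod>p\<in>{p. prime p \<and> p dvd d \<and> p > 2}. (real p - 1) / (real p - 2))
      else 0)"

definition hardy_littlewood_error :: "real \<Rightarrow> nat \<Rightarrow> real" where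
  "hardy_littlewood_error x d =
     real (prime_pair_count x d) -
     singular_series d * integral {2..x - real d} (\<lambda>t. 1 / (ln t * ln (t + real d)))"

text \<open>The error term is \<open>o(x / (ln x)^4)\<close> uniformly in \<open>d\<close>: the threshold
  for \<open>x\<close> may depend on \<open>\<epsilon>\<close> but not on \<open>d\<close>.\<close>

definition hardy_littlewood_hypothesis :: bool where
  "hardy_littlewood_hypothesis \<longleftrightarrow>
     (\<forall>\<epsilon>>0. \<forall>\<^sub>F x in at_top. \<forall>d. 2 \<le> d \<and> real d \<le> 8 / 9 * x \<longrightarrow>
        \<bar>hardy_littlewood_error x d\<bar> \<le> \<epsilon> * (x / (ln x) ^ 4))"

text \<open>One-based indexing: \<open>nth_prime 1 = 2\<close>.\<close>

definition nth_prime :: "nat \<Rightarrow> nat" where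
  "nth_prime j = enumerate {p. prime p} (j - 1)"

definition primorial :: "nat \<Rightarrow> nat" where
  "primorial k = (\<Prod>j=1..k. nth_prime j)"

definition is_primorial :: "nat \<Rightarrow> bool" where
  "is_primorial n \<longleftrightarrow> (\<exists>k\<ge>1. n = primorial k)"

end

theory Submission
  imports Defs "HOL-Real_Asymp.Real_Asymp"
begin

text \<open>
  Write \<open>L = ln x\<close>. Both the size of \<open>d\<close> and its prime factors influence the main term: enlarging \<open>d\<close>
  by \<open>h\<close> costs a factor of about \<open>1 - h / x\<close> in the integral, while having one more prime factor near \<open>L\<close>
  gains a factor of about \<open>1 + 1 / L\<close> in the singular series. So a primorial beats everything smaller as
  long as it is below \<open>x / L\<close>, and the next primorial (about \<open>L\<close> times larger) is too big once it
  exceeds \<open>x / L\<close>. Between consecutive primorials, proper multiples lose at least \<open>x / L^4\<close> through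
  the integral and non-multiples lose as much through the singular series, which dominates the error
  term. Differences above \<open>8/9 x\<close> are handled by applying the hypothesis at \<open>9/8 d\<close> instead of \<open>x\<close>.

  That consecutive primorials near \<open>x\<close> have ratio asymptotic to \<open>L\<close> is the prime number theorem,
  which is itself derived from the hypothesis. The singular series has mean value 1, so summing
  over differences counts prime pairs in parallelograms; approximating rectangles by thin
  parallelograms, the normalised numbers of primes \<open>F I\<close> and \<open>F J\<close> in two disjoint intervals satisfy
  \<open>F I * F J \<rightarrow> |I| * |J|\<close>, and three pairwise disjoint intervals force \<open>F I \<rightarrow> |I|\<close>.
\<close>

section \<open>The mean value of the singular series\<close>

text \<open>The crossover x / L is where the relative gain 1 / L of one extra prime, applied to a
  main term of size x / L^2, equals the integral loss d / L^2; for the smaller of two consecutive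
  primorials the same point sits a factor L lower, at x / L^2. The exponent 4 in the hypothesis is
  the scale of the tightest comparisons: a proper multiple of a primorial P of size about x / L^2
  costs at least P / L^2, and swapping a prime near L for its successor costs a relative 1 / L^2 of
  the main term. Near the crossovers only leading constants differ, and slack is measured in units
  of \<open>\<delta> / 64\<close>: each asymptotic approximation loses a few units, while the
  distance from the crossover supplies 16. Parallelograms arise because the hypothesis fixes p' - p
  and bounds p', so differencing in x and summing over d prescribes ranges for exactly these two
  quantities. With two intervals alone, the product law would still allow reciprocal distortions of
  the two factors.\<close>

definition twin_factor :: "nat \<Rightarrow> real" where
  "twin_factor n = (if prime n \<and> n > 2 then 1 - 1 / (real n - 1)\<^sup>2 else 1)"

lemma twin_factor_pos: "twin_factor n > 0"
proof (cases "prime n \<and> n > 2")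
  case True
  then have "(real n - 1)\<^sup>2 > 1\<^sup>2" by (intro power_strict_mono) auto
  then show ?thesis using True by (simp add: twin_factor_def field_simps)
qed (simp add: twin_factor_def)

lemma twin_factor_le_1: "twin_factor n \<le> 1"
  by (simp add: twin_factor_def)

lemma convergent_prod_twin_factor: "convergent_prod twin_factor"
proof (rule abs_convergent_prod_imp_convergent_prod, rule summable_imp_abs_convergent_prod)
  have "summable (\<lambda>n. 4 * (1 / real n ^ 2))"
    by (intro summable_mult) (use inverse_power_summable[of 2, where 'a = real] in \<open>simp add: field_simps\<close>)
  then show "summable (\<lambda>n. norm (twin_factor n - 1))"
  proof (rule summable_comparison_test'[where N = 0])
    fix n :: nat
    show "norm (norm (twin_factor n - 1)) \<le> 4 * (1 / real n ^ 2)"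
    proof (cases "prime n \<and> n > 2")
      case True
      then have "(real n)\<^sup>2 \<le> (2 * (real n - 1))\<^sup>2" by (intro power_mono) auto
      moreover have "real n - 1 > 0" using True by auto
      ultimately have "1 / (real n - 1)\<^sup>2 \<le> 4 * (1 / real n ^ 2)"
        using True by (simp add: field_simps power2_eq_square)
      then show ?thesis using True by (simp add: twin_factor_def)
    qed (auto simp: twin_factor_def)
  qed
qed

text \<open>All factors lie in (0, 1], so the partial products decrease to the constant. This
  one-sided bound later gives the upper estimate of the mean value for every D without an error
  term.\<close>

lemma twin_prime_const_pos: "twin_prime_const > 0"
  and twin_prime_const_le: "twin_prime_const \<le> (\<Prod>n\<le>N. twin_factor n)"
  and twin_prime_const_LIMSEQ: "(\<lambda>N. \<Prod>n\<le>N. twin_factor n) \<longlonglongrightarrow> twin_prime_const"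
proof -
  have eq: "twin_prime_const = prodinf twin_factor"
    by (simp add: twin_prime_const_def twin_factor_def[abs_def])
  show lim: "(\<lambda>N. \<Prod>n\<le>N. twin_factor n) \<longlonglongrightarrow> twin_prime_const"
    unfolding eq by (rule convergent_prod_LIMSEQ[OF convergent_prod_twin_factor])
  have dec: "decseq (\<lambda>N. \<Prod>n\<le>N. twin_factor n)"
  proof (rule decseq_SucI)
    fix N
    have "(\<Prod>n\<le>N. twin_factor n) * twin_factor (Suc N) \<le> (\<Prod>n\<le>N. twin_factor n) * 1"
      by (intro mult_left_mono twin_factor_le_1 prod_nonneg ballI less_imp_le twin_factor_pos)
    then show "(\<Prod>n\<le>Suc N. twin_factor n) \<le> (\<Prod>n\<le>N. twin_factor n)" by simp
  qed
  show "twin_prime_const \<le> (\<Prod>n\<le>N. twin_factor n)"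
    by (rule decseq_ge[OF dec lim])
  have "twin_prime_const \<noteq> 0" unfolding eq
    by (rule prodinf_nonzero[OF convergent_prod_twin_factor]) (metis twin_factor_pos less_irrefl)
  moreover have "twin_prime_const \<ge> 0"
    by (rule LIMSEQ_le_const[OF lim]) (intro exI allI impI prod_nonneg ballI less_imp_le twin_factor_pos)
  ultimately show "twin_prime_const > 0" by simp
qed

definition odd_primes_upto :: "nat \<Rightarrow> nat set" where
  "odd_primes_upto z = {p. prime p \<and> 2 < p \<and> p \<le> z}"

lemma finite_odd_primes_upto [simp]: "finite (odd_primes_upto z)"
  by (rule finite_subset[of _ "{..z}"]) (auto simp: odd_primes_upto_def)

text \<open>By (p - 1)^2 = p (p - 2) + 1 each factor is the reciprocal of a twin prime factor. This
  cancellation is what brings the mean of the singular series to 1.\<close>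

lemma prod_odd_primes_upto:
  "(\<Prod>p\<in>odd_primes_upto z. 1 + 1 / (real p * (real p - 2))) = 1 / (\<Prod>n\<le>z. twin_factor n)"
proof -
  have "(\<Prod>n\<le>z. twin_factor n) = (\<Prod>p\<in>odd_primes_upto z. twin_factor p)"
    by (rule prod.mono_neutral_right) (auto simp: odd_primes_upto_def twin_factor_def)
  moreover have "(\<Prod>p\<in>odd_primes_upto z. 1 + 1 / (real p * (real p - 2))) =
      (\<Prod>p\<in>odd_primes_upto z. 1 / twin_factor p)"
  proof (rule prod.cong[OF refl])
    fix p assume p: "p \<in> odd_primes_upto z"
    then have 1: "real p > 2" "twin_factor p = 1 - 1 / (real p - 1)\<^sup>2"
      by (auto simp: odd_primes_upto_def twin_factor_def)
    have "twin_factor p = real p * (real p - 2) / (real p - 1)\<^sup>2"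
    proof -
      have "real p * (real p - 2) = (real p - 1)\<^sup>2 - 1" by (simp add: power2_eq_square algebra_simps)
      then show ?thesis unfolding 1(2) using 1(1) by (simp add: diff_divide_distrib)
    qed
    then show "1 + 1 / (real p * (real p - 2)) = 1 / twin_factor p"
      using 1(1) by (simp add: field_simps power2_eq_square)
  qed
  ultimately show ?thesis by (simp add: prod_dividef)
qed

lemma prod_1_plus_eq_sum_Pow:
  fixes g :: "'a \<Rightarrow> 'b :: comm_semiring_1"
  assumes "finite A"
  shows "(\<Prod>x\<in>A. 1 + g x) = (\<Sum>T\<in>Pow A. \<Prod>x\<in>T. g x)"
  using prod_add[OF assms, of g "\<lambda>_. 1"] by (simp add: add.commute)

lemma prod_primes_dvd_iff:
  fixes T :: "nat set"
  assumes "finite T" "\<And>p. p \<in> T \<Longrightarrow> prime p"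
  shows "\<Prod>T dvd d \<longleftrightarrow> (\<forall>p\<in>T. p dvd d)"
  using assms
proof (induction T rule: finite_induct)
  case (insert q T)
  have "coprime q (\<Prod>T)"
    using insert by (intro prod_coprime_right) (metis insertCI primes_coprime)
  then have "q * \<Prod>T dvd d \<longleftrightarrow> q dvd d \<and> \<Prod>T dvd d"
    by (metis divides_mult dvd_mult_left dvd_mult_right)
  then show ?case using insert by simp
qed simp

lemma card_multiples:
  assumes "m > 0"
  shows "card {d\<in>{1..D}. m dvd d} = D div m"
proof -
  have "{d\<in>{1..D}. m dvd d} = (\<lambda>k. m * k) ` {1..D div m}"
    using assms by (auto simp: less_eq_div_iff_mult_less_eq algebra_simps elim!: dvdE)
  then show ?thesis using assms by (simp add: card_image inj_on_def)
qed

text \<open>Multiplying out the factors 1 + 1 / (p - 2) gives a sum over odd squarefree divisors,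
  each represented by its set T of primes. The cutoff \<open>D\<close> instead of \<open>d\<close>
  makes the index set common to all differences up to \<open>D\<close>, so that sums can be
  swapped.\<close>

lemma singular_series_even_eq:
  assumes "even d" "d > 0" "d \<le> D"
  shows "singular_series d = 2 * twin_prime_const *
    (\<Sum>T\<in>{T\<in>Pow (odd_primes_upto D). \<Prod>T dvd d}. \<Prod>p\<in>T. 1 / (real p - 2))"
proof -
  let ?A = "{p. prime p \<and> p dvd d \<and> p > 2}"
  have sub: "?A \<subseteq> odd_primes_upto D"
    using assms by (auto simp: odd_primes_upto_def dest: dvd_imp_le)
  have fin: "finite ?A" using sub by (rule finite_subset) simp
  have "(\<Prod>p\<in>?A. (real p - 1) / (real p - 2)) = (\<Prod>p\<in>?A. 1 + 1 / (real p - 2))"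
    by (rule prod.cong) (auto simp: field_simps)
  also have "\<dots> = (\<Sum>T\<in>Pow ?A. \<Prod>p\<in>T. 1 / (real p - 2))"
    by (rule prod_1_plus_eq_sum_Pow[OF fin])
  also have "Pow ?A = {T\<in>Pow (odd_primes_upto D). \<Prod>T dvd d}"
  proof (intro set_eqI iffI)
    fix T assume T: "T \<in> Pow ?A"
    then have "finite T" using fin finite_subset by auto
    then have "\<Prod>T dvd d" using T by (subst prod_primes_dvd_iff) auto
    then show "T \<in> {T\<in>Pow (odd_primes_upto D). \<Prod>T dvd d}" using T sub by auto
  next
    fix T assume T: "T \<in> {T\<in>Pow (odd_primes_upto D). \<Prod>T dvd d}"
    then have "finite T" using finite_subset[OF _ finite_odd_primes_upto[of D]] by auto
    then have "\<forall>p\<in>T. p dvd d" using T prod_primes_dvd_iff[of T d]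
      by (auto simp: odd_primes_upto_def subset_iff)
    then show "T \<in> Pow ?A" using T by (auto simp: odd_primes_upto_def)
  qed
  finally show ?thesis using assms by (simp add: singular_series_def)
qed

text \<open>After swapping the sums, only multiples have to be counted; since the primes in T are
  odd, evenness of d merges with divisibility into the single modulus
  \<open>2 * \<Prod>T\<close>.\<close>

lemma sum_singular_series_eq:
  "(\<Sum>d=1..D. singular_series d) = 2 * twin_prime_const *
    (\<Sum>T\<in>Pow (odd_primes_upto D). (\<Prod>p\<in>T. 1 / (real p - 2)) * real (D div (2 * \<Prod>T)))"
proof -
  let ?g = "\<lambda>T. \<Prod>p\<in>T. 1 / (real p - 2)"
  let ?B = "Pow (odd_primes_upto D)"
  have "(\<Sum>d=1..D. singular_series d) = (\<Sum>d=1..D. 2 * twin_prime_const *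
    (\<Sum>T\<in>?B. if 2 * \<Prod>T dvd d then ?g T else 0))"
  proof (rule sum.cong[OF refl])
    fix d assume d: "d \<in> {1..D}"
    show "singular_series d = 2 * twin_prime_const *
      (\<Sum>T\<in>?B. if 2 * \<Prod>T dvd d then ?g T else 0)"
    proof (cases "even d")
      case False
      then have "\<not> 2 * \<Prod>T dvd d" for T using dvd_mult_left by blast
      then show ?thesis using False by (simp add: singular_series_def)
    next
      case True
      have *: "2 * \<Prod>T dvd d \<longleftrightarrow> \<Prod>T dvd d" if "T \<in> ?B" for T
      proof -
        have "coprime 2 (\<Prod>T)"
          using that by (intro prod_coprime_right)
            (auto simp: odd_primes_upto_def subset_iff prime_odd_nat)
        then show ?thesis using True by (metis divides_mult dvd_mult_right)
      qed
      have "(\<Sum>T\<in>?B. if 2 * \<Prod>T dvd d then ?g T else 0) = (\<Sum>T\<in>?B. if \<Prod>T dvd d then ?g T else 0)"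
        by (rule sum.cong) (use * in auto)
      also have "\<dots> = (\<Sum>T\<in>{T\<in>?B. \<Prod>T dvd d}. ?g T)"
        by (rule sum.inter_filter[symmetric]) simp
      finally show ?thesis using singular_series_even_eq[OF True, of D] d by simp
    qed
  qed
  also have "\<dots> = 2 * twin_prime_const *
    (\<Sum>T\<in>?B. \<Sum>d=1..D. if 2 * \<Prod>T dvd d then ?g T else 0)"
    by (subst sum.swap) (simp add: sum_distrib_left)
  also have "(\<Sum>T\<in>?B. \<Sum>d=1..D. if 2 * \<Prod>T dvd d then ?g T else 0) =
      (\<Sum>T\<in>?B. ?g T * real (D div (2 * \<Prod>T)))"
  proof (rule sum.cong[OF refl])
    fix T assume T: "T \<in> ?B"
    then have "\<Prod>T > 0" by (intro prod_pos) (auto simp: odd_primes_upto_def subset_iff)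
    then have "card {d\<in>{1..D}. 2 * \<Prod>T dvd d} = D div (2 * \<Prod>T)"
      by (intro card_multiples) simp
    moreover have "(\<Sum>d=1..D. if 2 * \<Prod>T dvd d then ?g T else 0) = (\<Sum>d\<in>{d\<in>{1..D}. 2 * \<Prod>T dvd d}. ?g T)"
      by (rule sum.inter_filter[symmetric]) simp
    ultimately show "(\<Sum>d=1..D. if 2 * \<Prod>T dvd d then ?g T else 0) = ?g T * real (D div (2 * \<Prod>T))"
      by simp
  qed
  finally show ?thesis .
qed

lemma prod_inverse_pos:
  assumes "T \<subseteq> odd_primes_upto D"
  shows "(\<Prod>p\<in>T. 1 / (real p - 2)) > 0"
  using assms by (intro prod_pos) (auto simp: odd_primes_upto_def subset_iff)

lemma sum_Pow_odd_primes_upto: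
  "(\<Sum>T\<in>Pow (odd_primes_upto z). (\<Prod>p\<in>T. 1 / (real p - 2)) * (1 / real (\<Prod>T))) =
     1 / (\<Prod>n\<le>z. twin_factor n)"
proof -
  have "(\<Sum>T\<in>Pow (odd_primes_upto z). (\<Prod>p\<in>T. 1 / (real p - 2)) * (1 / real (\<Prod>T))) =
    (\<Sum>T\<in>Pow (odd_primes_upto z). \<Prod>p\<in>T. 1 / (real p * (real p - 2)))"
    by (rule sum.cong) (simp_all add: prod_dividef prod.distrib)
  also have "\<dots> = 1 / (\<Prod>n\<le>z. twin_factor n)"
    by (simp add: prod_1_plus_eq_sum_Pow[symmetric] prod_odd_primes_upto)
  finally show ?thesis .
qed

text \<open>Dropping the floors is harmless in this direction, and what remains is
  \<open>twin_prime_const\<close> divided by a partial product that is at least as large.\<close>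

lemma sum_singular_series_le: "(\<Sum>d=1..D. singular_series d) \<le> real D"
proof -
  let ?g = "\<lambda>T. \<Prod>p\<in>T. 1 / (real p - 2)"
  have "(\<Sum>T\<in>Pow (odd_primes_upto D). ?g T * real (D div (2 * \<Prod>T)))
      \<le> (\<Sum>T\<in>Pow (odd_primes_upto D). ?g T * (1 / real (\<Prod>T)) * (real D / 2))"
  proof (rule sum_mono)
    fix T assume "T \<in> Pow (odd_primes_upto D)"
    then have "?g T \<ge> 0" using prod_inverse_pos[of T D] by simp
    moreover have "real (D div (2 * \<Prod>T)) \<le> real D / real (2 * \<Prod>T)"
      by (rule of_nat_div_le_of_nat)
    then have "real (D div (2 * \<Prod>T)) \<le> (1 / real (\<Prod>T)) * (real D / 2)" by simp
    ultimately show "?g T * real (D div (2 * \<Prod>T)) \<le> ?g T * (1 / real (\<Prod>T)) * (real D / 2)"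
      unfolding mult.assoc by (intro mult_left_mono)
  qed
  also have "\<dots> = 1 / (\<Prod>n\<le>D. twin_factor n) * (real D / 2)"
    unfolding sum_distrib_right[symmetric] sum_Pow_odd_primes_upto ..
  finally have "(\<Sum>d=1..D. singular_series d) \<le>
     2 * twin_prime_const * (1 / (\<Prod>n\<le>D. twin_factor n) * (real D / 2))"
    unfolding sum_singular_series_eq using twin_prime_const_pos by (intro mult_left_mono) auto
  also have "\<dots> = twin_prime_const / (\<Prod>n\<le>D. twin_factor n) * real D" by simp
  also have "\<dots> \<le> 1 * real D"
    using twin_prime_const_le[of D] twin_prime_const_pos
    by (intro mult_right_mono) (auto simp: divide_le_eq_1)
  finally show ?thesis by simp
qed

text \<open>Keeping only the sets T of primes up to a fixed \<open>z\<close> leaves finitely many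
  terms, each losing at most its weight to the floor. Hence the loss \<open>K\<close> depends on
  \<open>z\<close> but not on D.\<close>

lemma sum_singular_series_ge:
  "\<exists>K. \<forall>D. (\<Sum>d=1..D. singular_series d) \<ge> twin_prime_const / (\<Prod>n\<le>z. twin_factor n) * real D - K"
proof -
  let ?g = "\<lambda>T. \<Prod>p\<in>T. 1 / (real p - 2)"
  define K where "K = 2 * twin_prime_const * (\<Sum>T\<in>Pow (odd_primes_upto z). ?g T)"
  have large: "(\<Sum>d=1..D. singular_series d) \<ge> twin_prime_const / (\<Prod>n\<le>z. twin_factor n) * real D - K"
    if D: "D \<ge> z" for D
  proof -
    have "(\<Sum>T\<in>Pow (odd_primes_upto z). ?g T * (1 / real (\<Prod>T)) * (real D / 2) - ?g T) \<le>
          (\<Sum>T\<in>Pow (odd_primes_upto z). ?g T * real (D div (2 * \<Prod>T)))"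
    proof (rule sum_mono)
      fix T assume T: "T \<in> Pow (odd_primes_upto z)"
      then have "?g T \<ge> 0" using prod_inverse_pos[of T z] by simp
      moreover have "real D / real (2 * \<Prod>T) - real (D div (2 * \<Prod>T)) \<le> 1"
        using real_of_int_div3[of "int D" "int (2 * \<Prod>T)"]
        by (simp only: of_int_of_nat_eq zdiv_int[symmetric])
      then have "(1 / real (\<Prod>T)) * (real D / 2) - 1 \<le> real (D div (2 * \<Prod>T))" by simp
      ultimately have "?g T * ((1 / real (\<Prod>T)) * (real D / 2) - 1) \<le> ?g T * real (D div (2 * \<Prod>T))"
        by (intro mult_left_mono)
      then show "?g T * (1 / real (\<Prod>T)) * (real D / 2) - ?g T \<le> ?g T * real (D div (2 * \<Prod>T))"
        by (simp add: right_diff_distrib mult.assoc)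
    qed
    also have "\<dots> \<le> (\<Sum>T\<in>Pow (odd_primes_upto D). ?g T * real (D div (2 * \<Prod>T)))"
    proof (rule sum_mono2)
      show "Pow (odd_primes_upto z) \<subseteq> Pow (odd_primes_upto D)"
        using D by (auto simp: odd_primes_upto_def)
      show "0 \<le> ?g T * real (D div (2 * \<Prod>T))"
        if "T \<in> Pow (odd_primes_upto D) - Pow (odd_primes_upto z)" for T
        using that prod_inverse_pos[of T D] by (intro mult_nonneg_nonneg) auto
    qed simp
    finally have "2 * twin_prime_const * (\<Sum>T\<in>Pow (odd_primes_upto z). ?g T * (1 / real (\<Prod>T)) * (real D / 2) - ?g T)
       \<le> (\<Sum>d=1..D. singular_series d)"
      unfolding sum_singular_series_eq using twin_prime_const_pos by (intro mult_left_mono) auto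
    also have "(\<Sum>T\<in>Pow (odd_primes_upto z). ?g T * (1 / real (\<Prod>T)) * (real D / 2) - ?g T) =
      1 / (\<Prod>n\<le>z. twin_factor n) * (real D / 2) - (\<Sum>T\<in>Pow (odd_primes_upto z). ?g T)"
      unfolding sum_subtractf sum_distrib_right[symmetric] sum_Pow_odd_primes_upto ..
    finally show ?thesis by (simp add: K_def algebra_simps)
  qed
  have nonneg: "(\<Sum>d=1..D. singular_series d) \<ge> 0" for D
    unfolding sum_singular_series_eq using twin_prime_const_pos
    by (intro mult_nonneg_nonneg sum_nonneg) (auto intro!: less_imp_le prod_inverse_pos[of _ D])
  let ?c = "twin_prime_const / (\<Prod>n\<le>z. twin_factor n)"
  have c: "?c \<ge> 0" using twin_prime_const_pos
    by (intro divide_nonneg_nonneg prod_nonneg ballI less_imp_le twin_factor_pos) auto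
  have K: "K \<ge> 0" unfolding K_def using twin_prime_const_pos
    by (intro mult_nonneg_nonneg sum_nonneg) (auto intro!: less_imp_le prod_inverse_pos[of _ z])
  \<comment> \<open>Below \<open>z\<close> only nonnegativity of the sum is used, so the constant is
    enlarged by \<open>?c * real z\<close> to make the bound trivial there.\<close>
  have "(\<Sum>d=1..D. singular_series d) \<ge> ?c * real D - (K + ?c * real z)" for D
  proof (cases "D \<ge> z")
    case True
    have "?c * real z \<ge> 0" using c by (intro mult_nonneg_nonneg) auto
    then show ?thesis using large[OF True] by linarith
  next
    case False
    then have "?c * real D \<le> ?c * real z" using c by (intro mult_left_mono) auto
    then show ?thesis using nonneg[of D] K by linarith
  qed
  then show ?thesis by blast
qed

text \<open>Two nested limits: \<open>z\<close> is fixed first, bringing the leading constant within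
  r / 2 of 1, and then D is taken large enough to absorb the \<open>z\<close>-dependent
  loss.\<close>

lemma mean_singular_series: "(\<lambda>D. (\<Sum>d=1..D. singular_series d) / real D) \<longlonglongrightarrow> 1"
proof (rule LIMSEQ_I)
  fix r :: real assume r: "r > 0"
  have "(\<lambda>z. twin_prime_const / (\<Prod>n\<le>z. twin_factor n)) \<longlonglongrightarrow> twin_prime_const / twin_prime_const"
    by (intro tendsto_divide tendsto_const twin_prime_const_LIMSEQ) (use twin_prime_const_pos in auto)
  then have "(\<lambda>z. twin_prime_const / (\<Prod>n\<le>z. twin_factor n)) \<longlonglongrightarrow> 1"
    using twin_prime_const_pos by simp
  then have "eventually (\<lambda>z. twin_prime_const / (\<Prod>n\<le>z. twin_factor n) > 1 - r / 2) sequentially"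
    using r by (intro order_tendstoD(1)[where y = 1]) auto
  then obtain z where z: "twin_prime_const / (\<Prod>n\<le>z. twin_factor n) > 1 - r / 2"
    by (meson eventually_happens' sequentially_bot)
  obtain K where K: "\<And>D. (\<Sum>d=1..D. singular_series d) \<ge> twin_prime_const / (\<Prod>n\<le>z. twin_factor n) * real D - K"
    using sum_singular_series_ge[of z] by blast
  obtain N where N: "real N > 2 * \<bar>K\<bar> / r" using reals_Archimedean2 by blast
  show "\<exists>no. \<forall>D\<ge>no. norm ((\<Sum>d=1..D. singular_series d) / real D - 1) < r"
  proof (intro exI[of _ "N + 1"] allI impI)
    fix D assume D: "D \<ge> N + 1"
    then have Dpos: "real D > 0" by simp
    have up: "(\<Sum>d=1..D. singular_series d) / real D \<le> 1"
      using sum_singular_series_le[of D] Dpos by (simp add: divide_le_eq)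
    have "2 * \<bar>K\<bar> / r < real D" using N D by linarith
    then have "\<bar>K\<bar> < r / 2 * real D" using r by (simp add: field_simps)
    then have "K < r / 2 * real D" by linarith
    moreover have "(1 - r / 2) * real D < twin_prime_const / (\<Prod>n\<le>z. twin_factor n) * real D"
      using z Dpos by (intro mult_strict_right_mono) auto
    ultimately have "(\<Sum>d=1..D. singular_series d) > (1 - r) * real D"
      using K[of D] by (simp add: algebra_simps)
    then have "(\<Sum>d=1..D. singular_series d) / real D > 1 - r"
      using Dpos by (simp add: less_divide_eq)
    then show "norm ((\<Sum>d=1..D. singular_series d) / real D - 1) < r"
      using up by simp
  qed
qed

section \<open>Prime pairs in parallelograms\<close>

lemma singular_series_nonneg: "singular_series d \<ge> 0"
  unfolding singular_series_def using twin_prime_const_pos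
  by (auto intro!: mult_nonneg_nonneg prod_nonneg divide_nonneg_nonneg)

lemma finite_nat_real_le: "finite {n :: nat. real n \<le> x \<and> P n}"
  by (rule finite_subset[of _ "{..nat \<lfloor>x\<rfloor>}"]) (auto simp: le_nat_floor)

lemma prime_pair_count_eq:
  "prime_pair_count x d = card {p. prime p \<and> prime (p + d) \<and> real (p + d) \<le> x}"
proof -
  have "{(p, p'). prime p \<and> prime p' \<and> real p \<le> x \<and> real p' \<le> x \<and> p' = p + d} =
    (\<lambda>p. (p, p + d)) ` {p. prime p \<and> prime (p + d) \<and> real (p + d) \<le> x}"
    by (auto simp: image_iff)
  then show ?thesis unfolding prime_pair_count_def by (simp add: card_image inj_on_def)
qed

lemma finite_prime_pairs: "finite {p. prime p \<and> prime (p + d) \<and> real (p + d) \<le> x}"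
  by (rule finite_subset[OF _ finite_nat_real_le[of x "\<lambda>_. True"]]) auto

lemma prime_pair_count_mono: "x \<le> y \<Longrightarrow> prime_pair_count x d \<le> prime_pair_count y d"
  unfolding prime_pair_count_eq by (intro card_mono finite_prime_pairs) auto

lemma prime_pair_count_diff:
  assumes "x \<le> y"
  shows "real (prime_pair_count y d) - real (prime_pair_count x d) =
    real (card {p. prime p \<and> prime (p + d) \<and> x < real (p + d) \<and> real (p + d) \<le> y})"
proof -
  let ?A = "\<lambda>x. {p. prime p \<and> prime (p + d) \<and> real (p + d) \<le> x}"
  have "{p. prime p \<and> prime (p + d) \<and> x < real (p + d) \<and> real (p + d) \<le> y} = ?A y - ?A x"
    using assms by auto
  moreover have "card (?A y - ?A x) = card (?A y) - card (?A x)"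
    using assms by (intro card_Diff_subset finite_prime_pairs) auto
  moreover have "card (?A x) \<le> card (?A y)"
    using assms by (intro card_mono finite_prime_pairs) auto
  ultimately show ?thesis by (simp add: prime_pair_count_eq)
qed

definition pair_integral :: "real \<Rightarrow> nat \<Rightarrow> real" where
  "pair_integral x d = integral {2..x - real d} (\<lambda>t. 1 / (ln t * ln (t + real d)))"

lemma integrable_pair_integrand:
  "a > 1 \<Longrightarrow> (\<lambda>t. 1 / (ln t * ln (t + real d))) integrable_on {a..b}"
  by (rule integrable_continuous_real) (auto intro!: continuous_intros)

lemma pair_integral_split:
  assumes "2 \<le> x - real d" "x \<le> y"
  shows "pair_integral y d = pair_integral x d +
    integral {x - real d..y - real d} (\<lambda>t. 1 / (ln t * ln (t + real d)))"
  unfolding pair_integral_def using assms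
  by (intro Henstock_Kurzweil_Integration.integral_combine[symmetric] integrable_pair_integrand) auto

lemma pair_integrand_integral_le:
  assumes "1 < u" "u \<le> v"
  shows "integral {u..v} (\<lambda>t. 1 / (ln t * ln (t + real d))) \<le> (v - u) / (ln u)\<^sup>2"
proof -
  have "integral {u..v} (\<lambda>t. 1 / (ln t * ln (t + real d))) \<le> integral {u..v} (\<lambda>t. 1 / (ln u)\<^sup>2)"
    using assms by (intro integral_le integrable_pair_integrand)
      (auto simp: power2_eq_square intro!: divide_left_mono mult_mono mult_pos_pos)
  then show ?thesis using assms by simp
qed

lemma pair_integrand_integral_ge:
  assumes "1 < u" "u \<le> v" "v + real d \<le> w"
  shows "(v - u) / (ln w)\<^sup>2 \<le> integral {u..v} (\<lambda>t. 1 / (ln t * ln (t + real d)))"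
proof -
  have "integral {u..v} (\<lambda>t. 1 / (ln w)\<^sup>2) \<le> integral {u..v} (\<lambda>t. 1 / (ln t * ln (t + real d)))"
    using assms by (intro integral_le integrable_pair_integrand)
      (auto simp: power2_eq_square intro!: divide_left_mono mult_mono mult_pos_pos)
  then show ?thesis using assms by simp
qed

text \<open>A parallelogram in the (p, p') plane, with two sides on lines of constant p' and two on
  diagonals of constant p' - p. It is the shape that increments of \<open>prime_pair_count\<close>
  in x, summed over d, count directly.\<close>

definition prime_pairs_in :: "real \<Rightarrow> real \<Rightarrow> real \<Rightarrow> real \<Rightarrow> (nat \<times> nat) set" where
  "prime_pairs_in c e b b' =
     {(p, p'). prime p \<and> prime p' \<and> c < real p' \<and> real p' \<le> e \<and>
        b < real p' - real p \<and> real p' - real p \<le> b'}"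

lemma card_prime_pairs_in:
  assumes "0 \<le> b" "c \<le> e"
  shows "real (card (prime_pairs_in c e b b')) =
    (\<Sum>d\<in>{d. b < real d \<and> real d \<le> b'}. real (prime_pair_count e d) - real (prime_pair_count c d))"
proof -
  let ?D = "{d. b < real d \<and> real d \<le> b'}"
  let ?B = "\<lambda>d. {p. prime p \<and> prime (p + d) \<and> c < real (p + d) \<and> real (p + d) \<le> e}"
  have finD: "finite ?D" by (rule finite_subset[OF _ finite_nat_real_le[of b' "\<lambda>_. True"]]) auto
  have finB: "finite (?B d)" for d
    by (rule finite_subset[OF _ finite_prime_pairs[of d e]]) auto
  have "prime_pairs_in c e b b' = (\<lambda>(d, p). (p, p + d)) ` (SIGMA d:?D. ?B d)"
  proof (intro set_eqI iffI)
    fix z assume z: "z \<in> prime_pairs_in c e b b'"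
    obtain p p' where pp: "z = (p, p')" by (cases z)
    have "p < p'" using z assms by (auto simp: prime_pairs_in_def pp)
    then have "(p' - p, p) \<in> (SIGMA d:?D. ?B d)" "z = (\<lambda>(d, p). (p, p + d)) (p' - p, p)"
      using z by (auto simp: prime_pairs_in_def pp of_nat_diff)
    then show "z \<in> (\<lambda>(d, p). (p, p + d)) ` (SIGMA d:?D. ?B d)" by blast
  qed (auto simp: prime_pairs_in_def)
  moreover have "inj_on (\<lambda>(d, p). (p, p + d)) (SIGMA d:?D. ?B d)"
    by (auto simp: inj_on_def)
  ultimately have "card (prime_pairs_in c e b b') = card (SIGMA d:?D. ?B d)"
    by (simp add: card_image)
  also have "\<dots> = (\<Sum>d\<in>?D. card (?B d))" using finD finB by simp
  finally show ?thesis by (simp only: of_nat_sum prime_pair_count_diff[OF assms(2)])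
qed

lemma finite_prime_pairs_in: "b \<ge> 0 \<Longrightarrow> finite (prime_pairs_in c e b b')"
  by (rule finite_subset[of _ "{..nat \<lfloor>e\<rfloor>} \<times> {..nat \<lfloor>e\<rfloor>}"])
     (auto simp: prime_pairs_in_def le_nat_floor)

lemma sum_singular_series_scaled:
  assumes "b > 0"
  shows "((\<lambda>x. (\<Sum>d=1..nat \<lfloor>b * x\<rfloor>. singular_series d) / x) \<longlongrightarrow> b) at_top"
proof -
  have 1: "filterlim (\<lambda>x. nat \<lfloor>b * x\<rfloor>) at_top at_top"
    using assms by real_asymp
  have 2: "((\<lambda>x. real (nat \<lfloor>b * x\<rfloor>) / x) \<longlongrightarrow> b) at_top"
    using assms by real_asymp
  have "((\<lambda>x. (\<Sum>d=1..nat \<lfloor>b * x\<rfloor>. singular_series d) / real (nat \<lfloor>b * x\<rfloor>) *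
       (real (nat \<lfloor>b * x\<rfloor>) / x)) \<longlongrightarrow> 1 * b) at_top"
    by (intro tendsto_mult 2 filterlim_compose[OF mean_singular_series 1])
  then have "((\<lambda>x. (\<Sum>d=1..nat \<lfloor>b * x\<rfloor>. singular_series d) / real (nat \<lfloor>b * x\<rfloor>) *
       (real (nat \<lfloor>b * x\<rfloor>) / x)) \<longlongrightarrow> b) at_top" by simp
  then show ?thesis
  proof (rule Lim_transform_eventually)
    have "eventually (\<lambda>x. nat \<lfloor>b * x\<rfloor> \<ge> 1) at_top"
      using 1 by (simp add: filterlim_at_top)
    then show "\<forall>\<^sub>F x in at_top. (\<Sum>d=1..nat \<lfloor>b * x\<rfloor>. singular_series d) / real (nat \<lfloor>b * x\<rfloor>) *
       (real (nat \<lfloor>b * x\<rfloor>) / x) = (\<Sum>d=1..nat \<lfloor>b * x\<rfloor>. singular_series d) / x"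
      by eventually_elim auto
  qed
qed

lemma sum_singular_series_scaled_diff:
  assumes "0 < b" "b < b'"
  shows "((\<lambda>x. (\<Sum>d\<in>{d. b * x < real d \<and> real d \<le> b' * x}. singular_series d) / x) \<longlongrightarrow> b' - b) at_top"
proof -
  have "((\<lambda>x. (\<Sum>d=1..nat \<lfloor>b' * x\<rfloor>. singular_series d) / x - (\<Sum>d=1..nat \<lfloor>b * x\<rfloor>. singular_series d) / x)
      \<longlongrightarrow> b' - b) at_top"
    using assms by (intro tendsto_diff sum_singular_series_scaled) auto
  then show ?thesis
  proof (rule Lim_transform_eventually)
    show "\<forall>\<^sub>F x in at_top. (\<Sum>d=1..nat \<lfloor>b' * x\<rfloor>. singular_series d) / x - (\<Sum>d=1..nat \<lfloor>b * x\<rfloor>. singular_series d) / x =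
      (\<Sum>d\<in>{d. b * x < real d \<and> real d \<le> b' * x}. singular_series d) / x"
      using eventually_gt_at_top[of 0]
    proof eventually_elim
      case (elim x)
      have le: "nat \<lfloor>b * x\<rfloor> \<le> nat \<lfloor>b' * x\<rfloor>" using assms elim
        by (intro nat_mono floor_mono mult_right_mono) auto
      have pos: "b * x > 0" "b' * x > 0" using assms elim by auto
      have "{d. b * x < real d \<and> real d \<le> b' * x} = {1..nat \<lfloor>b' * x\<rfloor>} - {1..nat \<lfloor>b * x\<rfloor>}"
        using pos by (auto simp: le_nat_iff le_floor_iff not_le nat_less_iff floor_less_iff) 
      then have "(\<Sum>d\<in>{d. b * x < real d \<and> real d \<le> b' * x}. singular_series d) =
        (\<Sum>d=1..nat \<lfloor>b' * x\<rfloor>. singular_series d) - (\<Sum>d=1..nat \<lfloor>b * x\<rfloor>. singular_series d)"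
        using le by (simp add: sum_diff)
      then show ?case by (simp add: diff_divide_distrib)
    qed
  qed
qed

lemma hardy_littlewood_bound:
  assumes hardy_littlewood_hypothesis "\<epsilon> > 0"
  shows "\<forall>\<^sub>F x in at_top. \<forall>d. 2 \<le> d \<and> real d \<le> 8 / 9 * x \<longrightarrow>
    \<bar>real (prime_pair_count x d) - singular_series d * pair_integral x d\<bar> \<le> \<epsilon> * (x / (ln x) ^ 4)"
  using assms unfolding hardy_littlewood_hypothesis_def hardy_littlewood_error_def pair_integral_def
  by blast

lemma eventually_at_top_scale:
  assumes "eventually P at_top" "c > (0 :: real)"
  shows "\<forall>\<^sub>F x in at_top. P (c * x)"
proof -
  have "filterlim (\<lambda>x. c * x) at_top at_top" using assms(2) by real_asymp
  then show ?thesis using assms(1) by (simp add: filterlim_iff)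
qed

text \<open>Each d contributes its singular series times an integral over an interval of length (e -
  c) x, on which both logarithms are asymptotic to \<open>ln x\<close>; the sum over d is then the
  mean value of the singular series. The bound on \<open>b'\<close> admits all these d at both
  cutoffs and keeps the interval above (c - b') x, a positive multiple of x.\<close>

lemma prime_pairs_in_asymp:
  assumes HL: hardy_littlewood_hypothesis
    and b: "0 < b" "b < b'" "b' \<le> 8 / 9 * c" and ce: "c < e"
  shows "((\<lambda>x. real (card (prime_pairs_in (c * x) (e * x) (b * x) (b' * x))) * (ln x)\<^sup>2 / x\<^sup>2)
      \<longlongrightarrow> (e - c) * (b' - b)) at_top"
proof -
  define A where "A = (\<lambda>x. (\<Sum>d\<in>{d. b * x < real d \<and> real d \<le> b' * x}. singular_series d) / x)"
  \<comment> \<open>The normalised total error: at most b' x differences, each with one hypothesis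
    error at e x and one at c x.\<close>
  define R where "R = (\<lambda>x. b' * (e / ln (e * x) ^ 4 + c / ln (c * x) ^ 4) * (ln x)\<^sup>2)"
  have cpos: "c > 0" "e > 0" "c - b' > 0" using b ce by auto
  have A: "(A \<longlongrightarrow> b' - b) at_top"
    unfolding A_def by (rule sum_singular_series_scaled_diff) (use b in auto)
  have R: "(R \<longlongrightarrow> 0) at_top" unfolding R_def using cpos by real_asymp
  have up: "((\<lambda>x. (e - c) * (ln x)\<^sup>2 / (ln ((c - b') * x))\<^sup>2 * A x + R x) \<longlongrightarrow> (e - c) * (b' - b) + 0) at_top"
  proof (intro tendsto_add tendsto_mult A R)
    show "((\<lambda>x. (e - c) * (ln x)\<^sup>2 / (ln ((c - b') * x))\<^sup>2) \<longlongrightarrow> e - c) at_top"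
      using cpos ce by real_asymp
  qed
  have lo: "((\<lambda>x. (e - c) * (ln x)\<^sup>2 / (ln (e * x))\<^sup>2 * A x - R x) \<longlongrightarrow> (e - c) * (b' - b) - 0) at_top"
  proof (intro tendsto_diff tendsto_mult A R)
    show "((\<lambda>x. (e - c) * (ln x)\<^sup>2 / (ln (e * x))\<^sup>2) \<longlongrightarrow> e - c) at_top"
      using cpos ce by real_asymp
  qed
  \<comment> \<open>The choice 1 for the error constant is enough: summed over O(x) differences the
    error is of order x^2 / L^4, against a main term of order x^2 / L^2.\<close>
  have hl: "\<forall>\<^sub>F x in at_top. \<forall>d. 2 \<le> d \<and> real d \<le> 8 / 9 * x \<longrightarrow>
    \<bar>real (prime_pair_count x d) - singular_series d * pair_integral x d\<bar> \<le> x / (ln x) ^ 4"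
    using hardy_littlewood_bound[OF HL, of 1] by simp
  have "\<forall>\<^sub>F x in at_top. c * x > 1" "\<forall>\<^sub>F x in at_top. b * x > 2" "\<forall>\<^sub>F x in at_top. (c - b') * x > 2"
    using cpos b by real_asymp+
  moreover have "\<forall>\<^sub>F x in at_top. x > (1 :: real)" by (rule eventually_gt_at_top)
  ultimately have bounds: "\<forall>\<^sub>F x in at_top.
      real (card (prime_pairs_in (c * x) (e * x) (b * x) (b' * x))) * (ln x)\<^sup>2 / x\<^sup>2
        \<le> (e - c) * (ln x)\<^sup>2 / (ln ((c - b') * x))\<^sup>2 * A x + R x \<and>
      (e - c) * (ln x)\<^sup>2 / (ln (e * x))\<^sup>2 * A x - R x
        \<le> real (card (prime_pairs_in (c * x) (e * x) (b * x) (b' * x))) * (ln x)\<^sup>2 / x\<^sup>2"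
    using eventually_at_top_scale[OF hl cpos(1)] eventually_at_top_scale[OF hl cpos(2)]
  proof eventually_elim
    case (elim x)
    let ?D = "{d. b * x < real d \<and> real d \<le> b' * x}"
    let ?G = "\<lambda>d. real (prime_pair_count (e * x) d) - real (prime_pair_count (c * x) d)"
    define E where "E = e * x / ln (e * x) ^ 4 + c * x / ln (c * x) ^ 4"
    have x: "x > 1" by fact
    have cx_ex: "c * x \<le> e * x" using ce x by simp
    have E0: "E \<ge> 0" unfolding E_def using elim x cpos by (auto intro!: add_nonneg_nonneg divide_nonneg_nonneg)
    have term_bounds: "?G d \<le> singular_series d * ((e - c) * x / (ln ((c - b') * x))\<^sup>2) + E \<and>
      singular_series d * ((e - c) * x / (ln (e * x))\<^sup>2) - E \<le> ?G d" if d: "d \<in> ?D" for d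
    proof -
      define J where "J = integral {c * x - real d..e * x - real d} (\<lambda>t. 1 / (ln t * ln (t + real d)))"
      have d2: "2 \<le> d" using d elim by auto
      have "b' * x \<le> 8 / 9 * c * x" using b x by (intro mult_right_mono) auto
      then have dc: "real d \<le> 8 / 9 * (c * x)" using d by auto
      then have de: "real d \<le> 8 / 9 * (e * x)" using cx_ex by linarith
      have u: "c * x - real d \<ge> (c - b') * x" using d by (simp add: algebra_simps)
      have split: "pair_integral (e * x) d = pair_integral (c * x) d + J"
        unfolding J_def using u elim cx_ex by (intro pair_integral_split) linarith+
      have "\<bar>?G d - singular_series d * J\<bar> \<le> E"
      proof -
        have "\<bar>real (prime_pair_count (c * x) d) - singular_series d * pair_integral (c * x) d\<bar> \<le> c * x / ln (c * x) ^ 4"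
             "\<bar>real (prime_pair_count (e * x) d) - singular_series d * pair_integral (e * x) d\<bar> \<le> e * x / ln (e * x) ^ 4"
          using elim d2 dc de by blast+
        then show ?thesis unfolding E_def split distrib_left by linarith
      qed
      moreover have "J \<le> (e - c) * x / (ln ((c - b') * x))\<^sup>2"
      proof -
        have "J \<le> (e * x - real d - (c * x - real d)) / (ln (c * x - real d))\<^sup>2"
          unfolding J_def using u elim cx_ex by (intro pair_integrand_integral_le) linarith+
        also have "\<dots> \<le> (e * x - real d - (c * x - real d)) / (ln ((c - b') * x))\<^sup>2"
          using u elim cx_ex cpos
          by (intro divide_left_mono power_mono zero_less_power mult_pos_pos ln_ge_zero iffD2[OF ln_le_cancel_iff]) auto
        finally show ?thesis by (simp add: algebra_simps)
      qed
      moreover have "(e - c) * x / (ln (e * x))\<^sup>2 \<le> J"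
      proof -
        have "(e * x - real d - (c * x - real d)) / (ln (e * x))\<^sup>2 \<le> J"
          unfolding J_def using u elim cx_ex by (intro pair_integrand_integral_ge) linarith+
        then show ?thesis by (simp add: algebra_simps)
      qed
      ultimately show ?thesis
        using mult_left_mono[OF _ singular_series_nonneg[of d], of J "(e - c) * x / (ln ((c - b') * x))\<^sup>2"]
          mult_left_mono[OF _ singular_series_nonneg[of d], of "(e - c) * x / (ln (e * x))\<^sup>2" J]
        by linarith
    qed
    have finD: "finite ?D" by (rule finite_subset[OF _ finite_nat_real_le[of "b' * x" "\<lambda>_. True"]]) auto
    have cardD: "real (card ?D) \<le> b' * x"
    proof -
      have "?D \<subseteq> {1..nat \<lfloor>b' * x\<rfloor>}" using elim by (auto simp: le_nat_floor intro!: Suc_leI gr0I)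
      then have "card ?D \<le> card {1..nat \<lfloor>b' * x\<rfloor>}" by (rule card_mono[rotated]) simp
      then have "card ?D \<le> nat \<lfloor>b' * x\<rfloor>" by simp
      moreover have "real (nat \<lfloor>b' * x\<rfloor>) \<le> b' * x" using b x by simp
      ultimately show ?thesis by linarith
    qed
    have ER: "b' * x * E * (ln x)\<^sup>2 / x\<^sup>2 = R x"
      unfolding E_def R_def using x by (simp add: field_simps power2_eq_square)
    have cardE: "real (card ?D) * E \<le> b' * x * E" using cardD E0 by (rule mult_right_mono)
    have sumA: "(\<Sum>d\<in>?D. singular_series d) = x * A x" using x by (simp add: A_def)
    have eq: "real (card (prime_pairs_in (c * x) (e * x) (b * x) (b' * x))) = sum ?G ?D"
      using b x cx_ex by (intro card_prime_pairs_in) auto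
    have "sum ?G ?D \<le> (\<Sum>d\<in>?D. singular_series d * ((e - c) * x / (ln ((c - b') * x))\<^sup>2) + E)"
      using term_bounds by (intro sum_mono) auto
    also have "\<dots> = x * A x * ((e - c) * x / (ln ((c - b') * x))\<^sup>2) + real (card ?D) * E"
      by (simp only: sum.distrib sum_distrib_right[symmetric] sumA sum_constant)
    finally have "sum ?G ?D \<le> x * A x * ((e - c) * x / (ln ((c - b') * x))\<^sup>2) + b' * x * E" using cardE by linarith
    then have "sum ?G ?D * (ln x)\<^sup>2 / x\<^sup>2 \<le>
       (x * A x * ((e - c) * x / (ln ((c - b') * x))\<^sup>2) + b' * x * E) * (ln x)\<^sup>2 / x\<^sup>2"
      by (intro divide_right_mono mult_right_mono) auto
    also have "\<dots> = x * A x * ((e - c) * x / (ln ((c - b') * x))\<^sup>2) * (ln x)\<^sup>2 / x\<^sup>2 + R x"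
      unfolding ER[symmetric] by (simp only: distrib_right add_divide_distrib)
    also have "x * A x * ((e - c) * x / (ln ((c - b') * x))\<^sup>2) * (ln x)\<^sup>2 / x\<^sup>2 =
       (e - c) * (ln x)\<^sup>2 / (ln ((c - b') * x))\<^sup>2 * A x"
      using x by (simp add: power2_eq_square)
    finally have 1: "sum ?G ?D * (ln x)\<^sup>2 / x\<^sup>2 \<le> (e - c) * (ln x)\<^sup>2 / (ln ((c - b') * x))\<^sup>2 * A x + R x" .
    have "x * A x * ((e - c) * x / (ln (e * x))\<^sup>2) - real (card ?D) * E
         = (\<Sum>d\<in>?D. singular_series d * ((e - c) * x / (ln (e * x))\<^sup>2) - E)"
      by (simp only: sum_subtractf sum_distrib_right[symmetric] sumA sum_constant)
    also have "\<dots> \<le> sum ?G ?D"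
      using term_bounds by (intro sum_mono) auto
    finally have "x * A x * ((e - c) * x / (ln (e * x))\<^sup>2) - b' * x * E \<le> sum ?G ?D" using cardE by linarith
    then have "(x * A x * ((e - c) * x / (ln (e * x))\<^sup>2) - b' * x * E) * (ln x)\<^sup>2 / x\<^sup>2 \<le> sum ?G ?D * (ln x)\<^sup>2 / x\<^sup>2"
      by (intro divide_right_mono mult_right_mono) auto
    also have "(x * A x * ((e - c) * x / (ln (e * x))\<^sup>2) - b' * x * E) * (ln x)\<^sup>2 / x\<^sup>2 =
       x * A x * ((e - c) * x / (ln (e * x))\<^sup>2) * (ln x)\<^sup>2 / x\<^sup>2 - R x"
      unfolding ER[symmetric] by (simp only: left_diff_distrib diff_divide_distrib)
    also have "x * A x * ((e - c) * x / (ln (e * x))\<^sup>2) * (ln x)\<^sup>2 / x\<^sup>2 =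
       (e - c) * (ln x)\<^sup>2 / (ln (e * x))\<^sup>2 * A x"
      using x by (simp add: power2_eq_square)
    finally show ?case unfolding eq using 1 by blast
  qed
  show ?thesis
    by (rule tendsto_sandwich[OF _ _ lo[simplified] up[simplified]])
       (use bounds in \<open>auto elim!: eventually_mono simp: field_simps\<close>)
qed

section \<open>The prime number theorem\<close>

definition prime_count_in :: "real \<Rightarrow> real \<Rightarrow> nat" where
  "prime_count_in a b = card {p. prime p \<and> a < real p \<and> real p \<le> b}"

lemma finite_primes_in: "finite {p. prime p \<and> a < real p \<and> real p \<le> b}"
  by (rule finite_subset[OF _ finite_nat_real_le[of b "\<lambda>_. True"]]) auto

text \<open>The extreme differences p' - p occur at opposite corners of the rectangle, so the
  rectangle lies inside this parallelogram.\<close>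

lemma prime_count_in_mult_le:
  assumes "b \<le> c"
  shows "prime_count_in a b * prime_count_in c e \<le> card (prime_pairs_in c e (c - b) (e - a))"
proof -
  have "card ({p. prime p \<and> a < real p \<and> real p \<le> b} \<times> {p. prime p \<and> c < real p \<and> real p \<le> e})
     \<le> card (prime_pairs_in c e (c - b) (e - a))"
    using assms by (intro card_mono finite_prime_pairs_in) (auto simp: prime_pairs_in_def)
  then show ?thesis by (simp add: prime_count_in_def card_cartesian_product)
qed

text \<open>In this parallelogram p = p' - (p' - p) is forced into the range from a to b, so it lies
  inside the rectangle.\<close>

lemma prime_count_in_mult_ge:
  assumes "b \<le> e"
  shows "card (prime_pairs_in c e (e - b) (c - a)) \<le> prime_count_in a b * prime_count_in c e"
proof -
  have "card (prime_pairs_in c e (e - b) (c - a)) \<le>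
      card ({p. prime p \<and> a < real p \<and> real p \<le> b} \<times> {p. prime p \<and> c < real p \<and> real p \<le> e})"
    using assms by (intro card_mono finite_cartesian_product finite_primes_in) (auto simp: prime_pairs_in_def)
  then show ?thesis by (simp add: prime_count_in_def card_cartesian_product)
qed

lemma prime_count_in_split:
  assumes "a \<le> b" "b \<le> c"
  shows "prime_count_in a c = prime_count_in a b + prime_count_in b c"
proof -
  have "{p. prime p \<and> a < real p \<and> real p \<le> c} =
    {p. prime p \<and> a < real p \<and> real p \<le> b} \<union> {p. prime p \<and> b < real p \<and> real p \<le> c}"
    using assms by auto
  then show ?thesis unfolding prime_count_in_def
    by (simp only:) (rule card_Un_disjoint, auto simp: finite_primes_in)
qed

lemma prime_count_in_sum:
  assumes "h \<ge> 0"
  shows "prime_count_in c (c + real N * h) =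
    (\<Sum>i<N. prime_count_in (c + real i * h) (c + (real i + 1) * h))"
proof (induction N)
  case 0
  have "{p. prime p \<and> c < real p \<and> real p \<le> c} = {}" by auto
  then have "prime_count_in c c = 0" unfolding prime_count_in_def by (simp only: card.empty)
  then show ?case by simp
next
  case (Suc N)
  have "prime_count_in c (c + real (Suc N) * h) = prime_count_in c (c + real N * h) +
     prime_count_in (c + real N * h) (c + real (Suc N) * h)"
    using assms by (intro prime_count_in_split) (auto simp: algebra_simps)
  then show ?case using Suc by (simp add: add.commute)
qed

text \<open>The range of p' is cut into N strips of height h. In a strip the circumscribed and
  inscribed parallelograms have areas h (b - a + h) and h (b - a - h), so the totals differ from the
  rectangle by only (e - c) h. The condition on e - a keeps every difference that occurs within 8 /
  9 of the strip's lower edge.\<close>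

lemma prime_count_in_mult_asymp:
  assumes HL: hardy_littlewood_hypothesis
    and "0 < a" "a < b" "b < c" "c < e" "e - a \<le> 8 / 9 * c"
  shows "((\<lambda>x. (real (prime_count_in (a * x) (b * x)) * ln x / x) *
      (real (prime_count_in (c * x) (e * x)) * ln x / x)) \<longlongrightarrow> (b - a) * (e - c)) at_top"
proof (rule tendstoI)
  fix r :: real assume r: "r > 0"
  let ?F = "\<lambda>x. (real (prime_count_in (a * x) (b * x)) * ln x / x) *
      (real (prime_count_in (c * x) (e * x)) * ln x / x)"
  \<comment> \<open>The first term makes h < b - a, so that the inscribed parallelograms are
    nondegenerate; the second makes the excess area (e - c) h less than r / 2.\<close>
  define K where "K = max ((e - c) / (b - a)) ((e - c)\<^sup>2 / (r / 2))"
  obtain N where N: "real N > K" using reals_Archimedean2 by blast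
  define h where "h = (e - c) / real N"
  have "K > 0" unfolding K_def using assms by (intro less_max_iff_disj[THEN iffD2] disjI1) auto
  then have Npos: "real N > 0" using N by linarith
  have h: "h > 0" "c + real N * h = e" using Npos assms by (auto simp: h_def)
  have "real N > (e - c) / (b - a)" "real N > (e - c)\<^sup>2 / (r / 2)" using N unfolding K_def by auto
  then have hb: "h < b - a" and hr: "(e - c) * h < r / 2"
    using Npos assms r by (auto simp: h_def field_simps power2_eq_square)
  define c' where "c' = (\<lambda>i :: nat. c + real i * h)"
  define U where "U = (\<lambda>i x. real (card (prime_pairs_in (c' i * x) ((c' i + h) * x)
     ((c' i - b) * x) ((c' i + h - a) * x))) * (ln x)\<^sup>2 / x\<^sup>2)"
  define V where "V = (\<lambda>i x. real (card (prime_pairs_in (c' i * x) ((c' i + h) * x)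
     ((c' i + h - b) * x) ((c' i - a) * x))) * (ln x)\<^sup>2 / x\<^sup>2)"
  have c'_ge: "c' i \<ge> c" for i using h by (simp add: c'_def)
  have c'_le: "c' i + h \<le> e" if "i < N" for i
  proof -
    have "(real i + 1) * h \<le> real N * h" using h that by (intro mult_right_mono) auto
    then show ?thesis unfolding c'_def h(2)[symmetric] by (simp add: algebra_simps)
  qed
  have "((\<lambda>x. \<Sum>i<N. U i x) \<longlongrightarrow> (\<Sum>i<N. ((c' i + h) - c' i) * ((c' i + h - a) - (c' i - b)))) at_top"
    unfolding U_def
  proof (intro tendsto_sum prime_pairs_in_asymp[OF HL])
    fix i assume "i \<in> {..<N}"
    then show "0 < c' i - b" "c' i - b < c' i + h - a" "c' i < c' i + h" "c' i + h - a \<le> 8 / 9 * c' i"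
      using assms h c'_ge[of i] c'_le[of i] by auto
  qed
  moreover have "(\<Sum>i<N. ((c' i + h) - c' i) * ((c' i + h - a) - (c' i - b))) = (b - a) * (e - c) + (e - c) * h"
    using Npos by (simp add: h_def field_simps)
  ultimately have Ulim: "((\<lambda>x. \<Sum>i<N. U i x) \<longlongrightarrow> (b - a) * (e - c) + (e - c) * h) at_top" by simp
  have "((\<lambda>x. \<Sum>i<N. V i x) \<longlongrightarrow> (\<Sum>i<N. ((c' i + h) - c' i) * ((c' i - a) - (c' i + h - b)))) at_top"
    unfolding V_def
  proof (intro tendsto_sum prime_pairs_in_asymp[OF HL])
    fix i assume "i \<in> {..<N}"
    then show "0 < c' i + h - b" "c' i + h - b < c' i - a" "c' i < c' i + h" "c' i - a \<le> 8 / 9 * c' i"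
      using assms h hb c'_ge[of i] c'_le[of i] by auto
  qed
  moreover have "(\<Sum>i<N. ((c' i + h) - c' i) * ((c' i - a) - (c' i + h - b))) = (b - a) * (e - c) - (e - c) * h"
    using Npos by (simp add: h_def field_simps)
  ultimately have Vlim: "((\<lambda>x. \<Sum>i<N. V i x) \<longlongrightarrow> (b - a) * (e - c) - (e - c) * h) at_top" by simp
  have "\<forall>\<^sub>F x in at_top. (\<Sum>i<N. U i x) < (b - a) * (e - c) + r"
    by (rule order_tendstoD(2)[OF Ulim]) (use hr r in auto)
  moreover have "\<forall>\<^sub>F x in at_top. (\<Sum>i<N. V i x) > (b - a) * (e - c) - r"
    by (rule order_tendstoD(1)[OF Vlim]) (use hr r in auto)
  ultimately show "\<forall>\<^sub>F x in at_top. dist (?F x) ((b - a) * (e - c)) < r"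
    using eventually_gt_at_top[of 1]
  proof eventually_elim
    case (elim x)
    have F_eq: "?F x = (\<Sum>i<N. real (prime_count_in (a * x) (b * x) *
       prime_count_in (c' i * x) ((c' i + h) * x)) * (ln x)\<^sup>2 / x\<^sup>2)"
    proof -
      have "e * x = c * x + real N * (h * x)" unfolding h(2)[symmetric] by (simp add: algebra_simps)
      then have "prime_count_in (c * x) (e * x) = (\<Sum>i<N. prime_count_in (c' i * x) ((c' i + h) * x))"
        using prime_count_in_sum[of "h * x" "c * x" N] h elim by (simp add: c'_def algebra_simps)
      then show ?thesis
        by (simp add: sum_distrib_left sum_distrib_right sum_divide_distrib power2_eq_square)
          (simp add: mult_ac)
    qed
    have "?F x \<le> (\<Sum>i<N. U i x)" unfolding F_eq U_def
    proof (intro sum_mono divide_right_mono mult_right_mono of_nat_mono)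
      fix i assume "i \<in> {..<N}"
      have "b * x \<le> c' i * x" using c'_ge[of i] assms elim by (intro mult_right_mono) auto
      then show "prime_count_in (a * x) (b * x) * prime_count_in (c' i * x) ((c' i + h) * x)
         \<le> card (prime_pairs_in (c' i * x) ((c' i + h) * x) ((c' i - b) * x) ((c' i + h - a) * x))"
        using prime_count_in_mult_le[of "b * x" "c' i * x" "a * x" "(c' i + h) * x"]
        by (simp add: left_diff_distrib)
    qed auto
    moreover have "(\<Sum>i<N. V i x) \<le> ?F x" unfolding F_eq V_def
    proof (intro sum_mono divide_right_mono mult_right_mono of_nat_mono)
      fix i assume "i \<in> {..<N}"
      have "b * x \<le> (c' i + h) * x" using c'_ge[of i] assms h elim by (intro mult_right_mono) auto
      then show "card (prime_pairs_in (c' i * x) ((c' i + h) * x) ((c' i + h - b) * x) ((c' i - a) * x))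
         \<le> prime_count_in (a * x) (b * x) * prime_count_in (c' i * x) ((c' i + h) * x)"
        using prime_count_in_mult_ge[of "b * x" "(c' i + h) * x" "c' i * x" "a * x"]
        by (simp add: left_diff_distrib)
    qed auto
    ultimately show ?case using elim by (simp add: dist_real_def)
  qed
qed

text \<open>Three disjoint intervals of equal length determine the square of one count as (F1 F2)
  (F1 F3) / (F2 F3), a quotient of products that all have the limit
  \<open>\<epsilon> * \<epsilon>\<close>; nonnegativity then picks the square root.\<close>

lemma prime_count_in_asymp:
  assumes HL: hardy_littlewood_hypothesis and \<epsilon>: "0 < \<epsilon>" "\<epsilon> \<le> 1 / 8"
  shows "((\<lambda>x. real (prime_count_in x ((1 + \<epsilon>) * x)) * ln x / x) \<longlongrightarrow> \<epsilon>) at_top"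
proof -
  define F where "F = (\<lambda>a x. real (prime_count_in (a * x) ((a + \<epsilon>) * x)) * ln x / x)"
  have F: "((\<lambda>x. F a x * F c x) \<longlongrightarrow> \<epsilon> * \<epsilon>) at_top"
    if "1 \<le> a" "a + \<epsilon> < c" "c + \<epsilon> - a \<le> 8 / 9 * c" for a c
    using prime_count_in_mult_asymp[OF HL, of a "a + \<epsilon>" c "c + \<epsilon>"] that \<epsilon> by (simp add: F_def)
  \<comment> \<open>Left endpoints are spaced by twice the length because the product law needs a
    strict gap; for lengths up to 1 / 8 all differences stay in the admissible range.\<close>
  let ?b = "1 + 2 * \<epsilon>" and ?c = "1 + 4 * \<epsilon>"
  have "((\<lambda>x. (F 1 x * F ?b x) * (F 1 x * F ?c x) / (F ?b x * F ?c x)) \<longlongrightarrow>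
     (\<epsilon> * \<epsilon>) * (\<epsilon> * \<epsilon>) / (\<epsilon> * \<epsilon>)) at_top"
    using \<epsilon> by (intro tendsto_divide tendsto_mult F) auto
  moreover have "\<forall>\<^sub>F x in at_top. F ?b x * F ?c x > 0"
    by (rule order_tendstoD(1)[OF F]) (use \<epsilon> in auto)
  then have "\<forall>\<^sub>F x in at_top. (F 1 x * F ?b x) * (F 1 x * F ?c x) / (F ?b x * F ?c x) = (F 1 x)\<^sup>2"
    by eventually_elim (auto simp: power2_eq_square)
  ultimately have "((\<lambda>x. (F 1 x)\<^sup>2) \<longlongrightarrow> (\<epsilon> * \<epsilon>) * (\<epsilon> * \<epsilon>) / (\<epsilon> * \<epsilon>)) at_top"
    by (rule Lim_transform_eventually)
  then have "((\<lambda>x. (F 1 x)\<^sup>2) \<longlongrightarrow> \<epsilon>\<^sup>2) at_top" using \<epsilon> by (simp add: power2_eq_square)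
  then have "((\<lambda>x. sqrt ((F 1 x)\<^sup>2)) \<longlongrightarrow> sqrt (\<epsilon>\<^sup>2)) at_top" by (rule tendsto_real_sqrt)
  moreover have "\<forall>\<^sub>F x in at_top. sqrt ((F 1 x)\<^sup>2) = F 1 x"
    using eventually_gt_at_top[of 1] by eventually_elim (simp add: F_def)
  ultimately have "(F 1 \<longlongrightarrow> sqrt (\<epsilon>\<^sup>2)) at_top" by (rule Lim_transform_eventually)
  then have "(F 1 \<longlongrightarrow> \<epsilon>) at_top" using \<epsilon> by simp
  then show ?thesis by (simp add: F_def[abs_def])
qed

section \<open>From interval counts to Chebyshev's function\<close>

definition chebyshev_theta :: "real \<Rightarrow> real" where
  "chebyshev_theta y = (\<Sum>p | prime p \<and> real p \<le> y. ln (real p))"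

lemma finite_primes_le_real: "finite {p. prime p \<and> real p \<le> y}"
  by (rule finite_subset[OF _ finite_nat_real_le[of y "\<lambda>_. True"]]) auto

lemma chebyshev_theta_diff:
  assumes "x \<le> y"
  shows "chebyshev_theta y - chebyshev_theta x = (\<Sum>p | prime p \<and> x < real p \<and> real p \<le> y. ln (real p))"
proof -
  have "{p. prime p \<and> x < real p \<and> real p \<le> y} = {p. prime p \<and> real p \<le> y} - {p. prime p \<and> real p \<le> x}"
    using assms by auto
  then show ?thesis unfolding chebyshev_theta_def using assms
    by (simp add: sum_diff[OF finite_primes_le_real] subset_iff)
qed

lemma chebyshev_theta_diff_asymp:
  assumes HL: hardy_littlewood_hypothesis and \<epsilon>: "0 < \<epsilon>" "\<epsilon> \<le> 1 / 8"
  shows "((\<lambda>x. (chebyshev_theta ((1 + \<epsilon>) * x) - chebyshev_theta x) / x) \<longlongrightarrow> \<epsilon>) at_top"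
proof (rule tendsto_sandwich)
  let ?N = "\<lambda>x. real (prime_count_in x ((1 + \<epsilon>) * x))"
  show "((\<lambda>x. ?N x * ln x / x) \<longlongrightarrow> \<epsilon>) at_top" by (rule prime_count_in_asymp) fact+
  have "((\<lambda>x. ln ((1 + \<epsilon>) * x) / ln x) \<longlongrightarrow> 1) at_top" using \<epsilon> by real_asymp
  then have "((\<lambda>x. ?N x * ln x / x * (ln ((1 + \<epsilon>) * x) / ln x)) \<longlongrightarrow> \<epsilon> * 1) at_top"
    by (intro tendsto_mult prime_count_in_asymp[OF assms])
  then show "((\<lambda>x. ?N x * ln x / x * (ln ((1 + \<epsilon>) * x) / ln x)) \<longlongrightarrow> \<epsilon>) at_top" by simp
  show "\<forall>\<^sub>F x in at_top. ?N x * ln x / x \<le> (chebyshev_theta ((1 + \<epsilon>) * x) - chebyshev_theta x) / x"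
    using eventually_gt_at_top[of 1]
  proof eventually_elim
    case (elim x)
    have "x \<le> (1 + \<epsilon>) * x" using \<epsilon> elim by simp
    then have "chebyshev_theta ((1 + \<epsilon>) * x) - chebyshev_theta x =
      (\<Sum>p | prime p \<and> x < real p \<and> real p \<le> (1 + \<epsilon>) * x. ln (real p))" by (rule chebyshev_theta_diff)
    also have "\<dots> \<ge> ?N x * ln x" unfolding prime_count_in_def
      using elim by (intro sum_bounded_below) auto
    finally show ?case using elim by (intro divide_right_mono) auto
  qed
  show "\<forall>\<^sub>F x in at_top. (chebyshev_theta ((1 + \<epsilon>) * x) - chebyshev_theta x) / x \<le>
     ?N x * ln x / x * (ln ((1 + \<epsilon>) * x) / ln x)"
    using eventually_gt_at_top[of 1]
  proof eventually_elim
    case (elim x)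
    have "x \<le> (1 + \<epsilon>) * x" using \<epsilon> elim by simp
    then have "chebyshev_theta ((1 + \<epsilon>) * x) - chebyshev_theta x =
      (\<Sum>p | prime p \<and> x < real p \<and> real p \<le> (1 + \<epsilon>) * x. ln (real p))" by (rule chebyshev_theta_diff)
    also have "\<dots> \<le> ?N x * ln ((1 + \<epsilon>) * x)" unfolding prime_count_in_def
      using elim by (intro sum_bounded_above) (auto intro!: iffD2[OF ln_le_cancel_iff])
    finally have "(chebyshev_theta ((1 + \<epsilon>) * x) - chebyshev_theta x) / x \<le> ?N x * ln ((1 + \<epsilon>) * x) / x"
      using elim by (intro divide_right_mono) auto
    also have "\<dots> = ?N x * ln x / x * (ln ((1 + \<epsilon>) * x) / ln x)" using elim by simp
    finally show ?case .
  qed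
qed

text \<open>Descending from x through x / q, x / q^2, and so on to a fixed block, the increments are
  small multiples of a geometric progression and sum to a small multiple of x. Local boundedness
  takes care of the final block.\<close>

lemma small_o_of_scaling_difference:
  fixes f :: "real \<Rightarrow> real"
  assumes q: "q > 1"
    and lim: "((\<lambda>x. (f (q * x) - f x) / x) \<longlongrightarrow> 0) at_top"
    and bdd: "\<And>a b. \<exists>C. \<forall>x\<in>{a..b}. \<bar>f x\<bar> \<le> C"
  shows "((\<lambda>x. f x / x) \<longlongrightarrow> 0) at_top"
proof (rule tendstoI)
  fix r :: real assume r: "r > 0"
  \<comment> \<open>Chosen so that the induction reproduces itself exactly: \<open>\<eta>\<close> z
    + (r / 2) z = (r / 2) (q z).\<close>
  define \<eta> where "\<eta> = r / 2 * (q - 1)"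
  have \<eta>: "\<eta> > 0" using r q by (simp add: \<eta>_def)
  have "\<forall>\<^sub>F x in at_top. dist ((f (q * x) - f x) / x) 0 < \<eta>"
    using tendstoD[OF lim \<eta>] .
  then obtain y0 where y0: "\<And>x. x \<ge> y0 \<Longrightarrow> \<bar>(f (q * x) - f x) / x\<bar> < \<eta>"
    by (auto simp: eventually_at_top_linorder dist_real_def)
  define y where "y = max y0 1"
  have y: "y \<ge> 1" "y \<ge> y0" by (auto simp: y_def)
  obtain C where C: "\<And>x. x \<in> {y..q * y} \<Longrightarrow> \<bar>f x\<bar> \<le> C" using bdd by blast
  \<comment> \<open>The induction extends the range by one factor q at a time, while
    \<open>C\<close>, a bound on the starting block from y to q y, does not grow.\<close>
  have "\<forall>x. y \<le> x \<and> x \<le> q ^ n * (q * y) \<longrightarrow> \<bar>f x\<bar> \<le> C + r / 2 * x" for n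
  proof (induction n)
    case 0
    show ?case
    proof (intro allI impI)
      fix x assume x: "y \<le> x \<and> x \<le> q ^ 0 * (q * y)"
      then have "\<bar>f x\<bar> \<le> C" by (intro C) auto
      moreover have "r / 2 * x \<ge> 0" using r y x by simp
      ultimately show "\<bar>f x\<bar> \<le> C + r / 2 * x" by linarith
    qed
  next
    case (Suc n)
    show ?case
    proof (intro allI impI)
      fix x assume x: "y \<le> x \<and> x \<le> q ^ Suc n * (q * y)"
      show "\<bar>f x\<bar> \<le> C + r / 2 * x"
      proof (cases "x \<le> q * y")
        case True
        then have "\<bar>f x\<bar> \<le> C" using x by (intro C) auto
        moreover have "r / 2 * x \<ge> 0" using r y x by simp
        ultimately show ?thesis by linarith
      next
        case False
        define z where "z = x / q"
        have z: "x = q * z" using q by (simp add: z_def)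
        have zy: "y \<le> z" "z \<le> q ^ n * (q * y)" using False x q by (auto simp: z_def field_simps)
        have "\<bar>f x - f z\<bar> / z < \<eta>" using y0[of z] zy y by (simp add: z)
        then have "\<bar>f x - f z\<bar> \<le> \<eta> * z" using zy y by (simp add: divide_less_eq)
        moreover have "\<bar>f z\<bar> \<le> C + r / 2 * z" using Suc zy by blast
        moreover have "\<eta> * z + r / 2 * z = r / 2 * x" unfolding z \<eta>_def by (simp add: field_simps)
        ultimately show ?thesis by linarith
      qed
    qed
  qed
  moreover have "\<exists>n. x \<le> q ^ n * (q * y)" for x
  proof -
    obtain n where "x < q ^ n" using real_arch_pow[OF q] by blast
    moreover have "q ^ n * 1 \<le> q ^ n * (q * y)" using q y
      by (intro mult_left_mono) (auto intro: order_trans[OF _ mult_mono[of 1 q 1 y]])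
    ultimately show ?thesis by (intro exI[of _ n]) linarith
  qed
  ultimately have bound: "\<bar>f x\<bar> \<le> C + r / 2 * x" if "x \<ge> y" for x using that by blast
  have "\<forall>\<^sub>F x in at_top. C < r / 2 * x" using r by real_asymp
  then show "\<forall>\<^sub>F x in at_top. dist (f x / x) 0 < r"
    using eventually_ge_at_top[of y]
  proof eventually_elim
    case (elim x)
    then have "\<bar>f x\<bar> < r * x" using bound[of x] by (simp add: field_simps)
    then show ?case using elim y by (simp add: dist_real_def divide_less_eq)
  qed
qed

lemma chebyshev_theta_mono: "x \<le> y \<Longrightarrow> chebyshev_theta x \<le> chebyshev_theta y"
  unfolding chebyshev_theta_def
  by (rule sum_mono2[OF finite_primes_le_real]) (auto intro!: ln_ge_zero simp: Suc_le_eq prime_gt_0_nat)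

text \<open>The scaling lemma is applied to the deviation of theta from x, with ratio 9 / 8, a step
  for which the interval asymptotics are available.\<close>

lemma chebyshev_theta_asymp:
  assumes HL: hardy_littlewood_hypothesis
  shows "((\<lambda>x. chebyshev_theta x / x) \<longlongrightarrow> 1) at_top"
proof -
  let ?f = "\<lambda>x. chebyshev_theta x - x"
  have "((\<lambda>x. ?f x / x) \<longlongrightarrow> 0) at_top"
  proof (rule small_o_of_scaling_difference)
    show "(1 :: real) < 1 + 1 / 8" by simp
    have "((\<lambda>x. (chebyshev_theta ((1 + 1 / 8) * x) - chebyshev_theta x) / x - 1 / 8) \<longlongrightarrow> 1 / 8 - 1 / 8) at_top"
      by (intro tendsto_diff chebyshev_theta_diff_asymp[OF HL]) auto
    moreover have "\<forall>\<^sub>F x in at_top. (chebyshev_theta ((1 + 1 / 8) * x) - chebyshev_theta x) / x - 1 / 8 =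
       (?f ((1 + 1 / 8) * x) - ?f x) / x"
      using eventually_gt_at_top[of 0] by eventually_elim (simp add: field_simps)
    ultimately have "((\<lambda>x. (?f ((1 + 1 / 8) * x) - ?f x) / x) \<longlongrightarrow> 1 / 8 - 1 / 8) at_top"
      by (rule Lim_transform_eventually)
    then show "((\<lambda>x. (?f ((1 + 1 / 8) * x) - ?f x) / x) \<longlongrightarrow> 0) at_top" by simp
    show "\<exists>C. \<forall>x\<in>{a..b}. \<bar>?f x\<bar> \<le> C" for a b
    proof (intro exI ballI)
      fix x assume x: "x \<in> {a..b}"
      then have "chebyshev_theta a \<le> chebyshev_theta x" "chebyshev_theta x \<le> chebyshev_theta b"
        by (auto intro!: chebyshev_theta_mono)
      then show "\<bar>?f x\<bar> \<le> \<bar>chebyshev_theta a\<bar> + \<bar>chebyshev_theta b\<bar> + \<bar>a\<bar> + \<bar>b\<bar>" using x by auto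
    qed
  qed
  then have "((\<lambda>x. ?f x / x + 1) \<longlongrightarrow> 0 + 1) at_top" by (intro tendsto_intros)
  moreover have "\<forall>\<^sub>F x in at_top. ?f x / x + 1 = chebyshev_theta x / x"
    using eventually_gt_at_top[of 0] by eventually_elim (simp add: field_simps)
  ultimately have "((\<lambda>x. chebyshev_theta x / x) \<longlongrightarrow> 0 + 1) at_top"
    by (rule Lim_transform_eventually)
  then show ?thesis by simp
qed

text \<open>Consequently consecutive primes have ratio tending to 1, which will let
  \<open>next_prime q\<close> be replaced by \<open>q\<close> in asymptotic estimates.\<close>

lemma eventually_prime_in:
  assumes HL: hardy_littlewood_hypothesis and \<epsilon>: "0 < \<epsilon>"
  shows "\<forall>\<^sub>F x in at_top. \<exists>p. prime p \<and> x < real p \<and> real p \<le> (1 + \<epsilon>) * x"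
proof -
  define \<epsilon>' where "\<epsilon>' = min \<epsilon> (1 / 8)"
  have \<epsilon>': "0 < \<epsilon>'" "\<epsilon>' \<le> 1 / 8" "\<epsilon>' \<le> \<epsilon>" using \<epsilon> by (auto simp: \<epsilon>'_def)
  have "\<forall>\<^sub>F x in at_top. real (prime_count_in x ((1 + \<epsilon>') * x)) * ln x / x > 0"
    by (rule order_tendstoD(1)[OF prime_count_in_asymp[OF HL]]) (use \<epsilon>' in auto)
  then show ?thesis using eventually_gt_at_top[of 0]
  proof eventually_elim
    case (elim x)
    then have "prime_count_in x ((1 + \<epsilon>') * x) \<noteq> 0" by (intro notI) simp
    then have "{p. prime p \<and> x < real p \<and> real p \<le> (1 + \<epsilon>') * x} \<noteq> {}"
      unfolding prime_count_in_def by (intro notI) simp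
    then obtain p where p: "prime p" "x < real p" "real p \<le> (1 + \<epsilon>') * x" by blast
    moreover have "(1 + \<epsilon>') * x \<le> (1 + \<epsilon>) * x" using \<epsilon>' elim by (intro mult_right_mono) auto
    ultimately have "prime p \<and> x < real p \<and> real p \<le> (1 + \<epsilon>) * x" by linarith
    then show ?case by blast
  qed
qed

section \<open>Extremality of primorials\<close>

definition sing_factor :: "nat \<Rightarrow> real" where
  "sing_factor p = (real p - 1) / (real p - 2)"

lemma sing_factor_eq: "p > 2 \<Longrightarrow> sing_factor p = 1 + 1 / (real p - 2)"
  by (simp add: sing_factor_def field_simps)

lemma sing_factor_gt_1: "p > 2 \<Longrightarrow> sing_factor p > 1"
  by (simp add: sing_factor_eq)

lemma sing_factor_antimono: "2 < p \<Longrightarrow> p \<le> q \<Longrightarrow> sing_factor q \<le> sing_factor p"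
  by (simp add: sing_factor_eq) (intro divide_left_mono mult_pos_pos, auto)

definition primes_below :: "nat \<Rightarrow> nat set" where
  "primes_below q = {p. prime p \<and> p < q}"

definition odd_primes_below :: "nat \<Rightarrow> nat set" where
  "odd_primes_below q = {p. prime p \<and> 2 < p \<and> p < q}"

lemma finite_primes_below [simp]: "finite (primes_below q)"
  by (rule finite_subset[of _ "{..<q}"]) (auto simp: primes_below_def)

lemma finite_odd_primes_below [simp]: "finite (odd_primes_below q)"
  by (rule finite_subset[of _ "{..<q}"]) (auto simp: odd_primes_below_def)

lemma primes_below_eq: "q > 2 \<Longrightarrow> primes_below q = insert 2 (odd_primes_below q)"
  by (auto simp: primes_below_def odd_primes_below_def dest: prime_gt_1_nat)

text \<open>Compare with the set B of primes up to \<open>q\<close>: members of B missing from A are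
  at most \<open>q\<close>, members of A outside B exceed \<open>q\<close>, and there are at least
  as many of the latter. The common part cancels.\<close>

lemma prod_primes_ge:
  fixes A :: "nat set"
  assumes A: "finite A" "\<And>p. p \<in> A \<Longrightarrow> prime p" and q: "prime q"
    and card: "card A > card (primes_below q)"
  shows "\<Prod>A \<ge> q * \<Prod>(primes_below q)"
proof -
  define B where "B = insert q (primes_below q)"
  have B: "finite B" "card B = Suc (card (primes_below q))" "\<Prod>B = q * \<Prod>(primes_below q)"
    by (auto simp: B_def primes_below_def[of q])
  have BA: "card (B - A) \<le> card (A - B)"
  proof -
    have "card A = card (A \<inter> B) + card (A - B)" "card B = card (A \<inter> B) + card (B - A)"
      using A B by (metis card_Int_Diff, metis card_Int_Diff Int_commute)
    then show ?thesis using card B by linarith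
  qed
  have "\<Prod>(B - A) \<le> q ^ card (B - A)"
    using prime_ge_1_nat[OF q] by (intro prod_le_power) (auto simp: B_def primes_below_def)
  also have "\<dots> \<le> q ^ card (A - B)"
    using BA by (intro power_increasing prime_ge_1_nat[OF q]) auto
  also have "\<dots> \<le> \<Prod>(A - B)"
    using A by (subst prod_constant[symmetric], intro prod_mono) (auto simp: B_def primes_below_def not_less)
  finally have "\<Prod>(A \<inter> B) * \<Prod>(B - A) \<le> \<Prod>(A \<inter> B) * \<Prod>(A - B)" by simp
  moreover have "\<Prod>A = \<Prod>(A \<inter> B) * \<Prod>(A - B)"
    using A by (metis prod.Int_Diff)
  moreover have "\<Prod>B = \<Prod>(A \<inter> B) * \<Prod>(B - A)"
    using B by (metis prod.Int_Diff Int_commute)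
  ultimately show ?thesis using B by simp
qed

lemma card_prime_divisors_le:
  assumes "prime q" "d > 0" "d < q * \<Prod>(primes_below q)"
  shows "card {p. prime p \<and> p dvd d} \<le> card (primes_below q)"
proof (rule ccontr)
  let ?A = "{p. prime p \<and> p dvd d}"
  assume "\<not> ?thesis"
  moreover have fin: "finite ?A"
    by (rule finite_subset[of _ "{..d}"]) (use assms in \<open>auto dest: dvd_imp_le\<close>)
  ultimately have "\<Prod>?A \<ge> q * \<Prod>(primes_below q)"
    using assms by (intro prod_primes_ge) auto
  moreover have "\<Prod>?A dvd d" using fin by (subst prod_primes_dvd_iff) auto
  then have "\<Prod>?A \<le> d" using assms by (intro dvd_imp_le) auto
  ultimately show False using assms by linarith
qed

text \<open>Local factors decrease with the prime, so replacing primes from \<open>q\<close> on by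
  missing primes below \<open>q\<close> never lowers the product. The second part quantifies a
  genuine exchange: with \<open>q0\<close> a bound for all primes below \<open>q\<close>, at least
  one swap gains the ratio of the factors at \<open>q0\<close> and \<open>q\<close>.\<close>

lemma prod_sing_factor_exchange:
  assumes A: "finite A" "\<And>p. p \<in> A \<Longrightarrow> prime p \<and> 2 < p"
    and card: "card A \<le> card (odd_primes_below q)" and q: "q > 2"
  shows "prod sing_factor A \<le> prod sing_factor (odd_primes_below q)"
    and "\<lbrakk>\<not> odd_primes_below q \<subseteq> A; 2 < q0; \<And>p. prime p \<Longrightarrow> p < q \<Longrightarrow> p \<le> q0; q0 \<le> q\<rbrakk>
       \<Longrightarrow> prod sing_factor A * sing_factor q0 \<le> prod sing_factor (odd_primes_below q) * sing_factor q"
proof -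
  let ?B = "odd_primes_below q"
  define m n where "m = card (A - ?B)" and "n = card (?B - A)"
  have mn: "m \<le> n"
  proof -
    have "card A = card (A \<inter> ?B) + card (A - ?B)" "card ?B = card (A \<inter> ?B) + card (?B - A)"
      using A by (metis card_Int_Diff, metis card_Int_Diff Int_commute finite_odd_primes_below)
    then show ?thesis using card by (simp add: m_def n_def)
  qed
  have f1: "sing_factor p \<ge> 1" if "p > 2" for p using sing_factor_gt_1[OF that] by simp
  have fAB: "prod sing_factor (A \<inter> ?B) \<ge> 0" using A f1 by (intro prod_nonneg) (meson IntD1 order_trans zero_le_one)
  have eqA: "prod sing_factor A = prod sing_factor (A \<inter> ?B) * prod sing_factor (A - ?B)"
    using A by (metis prod.Int_Diff)
  have eqB: "prod sing_factor ?B = prod sing_factor (A \<inter> ?B) * prod sing_factor (?B - A)"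
    by (metis prod.Int_Diff Int_commute finite_odd_primes_below)
  have upper: "prod sing_factor (A - ?B) \<le> sing_factor q ^ m"
    unfolding m_def
  proof (intro prod_le_power)
    show "0 \<le> sing_factor p \<and> sing_factor p \<le> sing_factor q" if "p \<in> A - ?B" for p
      using that A q f1[of p] by (force simp: odd_primes_below_def intro!: sing_factor_antimono)
  qed (use f1 q in auto)
  \<comment> \<open>Stated for a variable bound \<open>r\<close> because it is needed both with
    \<open>q\<close> and with the sharper \<open>q0\<close>.\<close>
  have lower: "sing_factor r ^ n \<le> prod sing_factor (?B - A)"
    if "2 < r" "\<And>p. p \<in> ?B \<Longrightarrow> p \<le> r" for r
    unfolding n_def using that f1[of r]
    by (subst prod_constant[symmetric], intro prod_mono)
       (auto simp: odd_primes_below_def intro!: sing_factor_antimono)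
  have "sing_factor q ^ m \<le> sing_factor q ^ n"
    using mn f1 q by (intro power_increasing) auto
  also have "\<dots> \<le> prod sing_factor (?B - A)"
    using q by (intro lower) (auto simp: odd_primes_below_def)
  finally have "prod sing_factor (A - ?B) \<le> prod sing_factor (?B - A)" using upper by linarith
  then show "prod sing_factor A \<le> prod sing_factor ?B"
    unfolding eqA eqB using fAB by (rule mult_left_mono)
  assume *: "\<not> ?B \<subseteq> A" "2 < q0" "\<And>p. prime p \<Longrightarrow> p < q \<Longrightarrow> p \<le> q0" "q0 \<le> q"
  \<comment> \<open>One missing prime guarantees one exchange; that one supplies the ratio of
    factors, and the remaining \<open>k\<close> are only used as not losing.\<close>
  have "n \<noteq> 0" using *(1) by (simp add: n_def)
  then obtain k where k: "n = Suc k" by (cases n) auto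
  have ff: "sing_factor q \<le> sing_factor q0" using * by (intro sing_factor_antimono) auto
  have "prod sing_factor (A - ?B) * sing_factor q0 \<le> sing_factor q ^ m * sing_factor q0"
    using upper f1[of q0] * by (intro mult_right_mono) auto
  also have "\<dots> \<le> sing_factor q ^ n * sing_factor q0"
    using mn f1[of q] f1[of q0] q * by (intro mult_right_mono power_increasing) auto
  also have "\<dots> = sing_factor q ^ k * (sing_factor q0 * sing_factor q)" by (simp add: k)
  also have "\<dots> \<le> sing_factor q0 ^ k * (sing_factor q0 * sing_factor q)"
    using f1[of q] f1[of q0] q * ff by (intro mult_right_mono power_mono) auto
  also have "\<dots> = sing_factor q0 ^ n * sing_factor q" by (simp add: k)
  also have "\<dots> \<le> prod sing_factor (?B - A) * sing_factor q"
    using f1[of q] q * by (intro mult_right_mono lower) (auto simp: odd_primes_below_def)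
  finally show "prod sing_factor A * sing_factor q0 \<le> prod sing_factor ?B * sing_factor q"
    unfolding eqA eqB mult.assoc using fAB by (rule mult_left_mono)
qed

text \<open>Indexing primorials by their largest prime factor avoids the enumeration of the primes.\<close>

definition primorial_upto :: "nat \<Rightarrow> nat" where
  "primorial_upto q = \<Prod>{p. prime p \<and> p \<le> q}"

definition next_prime :: "nat \<Rightarrow> nat" where
  "next_prime q = (LEAST p. prime p \<and> q < p)"

lemma next_prime: "prime (next_prime q)" "q < next_prime q"
  using LeastI_ex[OF bigger_prime[of q]] by (auto simp: next_prime_def)

lemma next_prime_le: "prime p \<Longrightarrow> q < p \<Longrightarrow> next_prime q \<le> p"
  unfolding next_prime_def by (rule Least_le) auto

lemma primes_below_next_prime: "primes_below (next_prime q) = {p. prime p \<and> p \<le> q}"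
proof -
  have "p < next_prime q \<longleftrightarrow> p \<le> q" if "prime p" for p
    using next_prime(2)[of q] next_prime_le[OF that, of q] by (auto simp: not_less[symmetric])
  then show ?thesis by (auto simp: primes_below_def)
qed

lemma prod_primes_below_next_prime: "\<Prod>(primes_below (next_prime q)) = primorial_upto q"
  by (simp add: primes_below_next_prime primorial_upto_def)

lemma primorial_upto_prime: "prime q \<Longrightarrow> primorial_upto q = q * \<Prod>(primes_below q)"
proof -
  assume "prime q"
  then have "{p. prime p \<and> p \<le> q} = insert q (primes_below q)" by (auto simp: primes_below_def)
  then show ?thesis by (simp add: primorial_upto_def) (simp add: primes_below_def)
qed

lemma primorial_upto_next: "primorial_upto (next_prime q) = next_prime q * primorial_upto q"
  using primorial_upto_prime[OF next_prime(1)] by (simp add: prod_primes_below_next_prime)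

lemma primorial_upto_pos: "primorial_upto q > 0"
  unfolding primorial_upto_def by (intro prod_pos) (auto simp: prime_gt_0_nat)

lemma primorial_upto_mono: "q \<le> r \<Longrightarrow> primorial_upto q \<le> primorial_upto r"
  unfolding primorial_upto_def
  by (intro dvd_imp_le prod_dvd_prod_subset prod_pos) (auto simp: prime_gt_0_nat)

lemma even_primorial_upto: "prime q \<Longrightarrow> even (primorial_upto q)"
  unfolding primorial_upto_def
  by (rule dvd_prodI[of _ 2 "\<lambda>x. x", simplified]) (auto simp: prime_ge_2_nat)

section \<open>The singular series at and below primorials\<close>

lemma singular_series_eq: "even d \<Longrightarrow> singular_series d =
    2 * twin_prime_const * prod sing_factor {p. prime p \<and> p dvd d \<and> p > 2}"
  by (simp add: singular_series_def sing_factor_def)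

lemma finite_prime_divisors: "d > 0 \<Longrightarrow> finite {p. prime p \<and> p dvd d \<and> P p}" for d :: nat
  by (rule finite_subset[of _ "{..d}"]) (auto dest: dvd_imp_le)

lemma prime_divisors_primorial_upto:
  "{p. prime p \<and> p dvd primorial_upto q \<and> p > 2} = odd_primes_below (Suc q)"
  (is "?L = ?R")
proof
  show "?R \<subseteq> ?L" unfolding primorial_upto_def odd_primes_below_def
    by (auto intro: dvd_prodI[of _ _ "\<lambda>x. x", simplified])
  show "?L \<subseteq> ?R"
  proof
    fix p assume p: "p \<in> ?L"
    then have "\<exists>r\<in>{p. prime p \<and> p \<le> q}. p dvd r"
      unfolding primorial_upto_def using prime_dvd_prod_iff[of "{p. prime p \<and> p \<le> q}" p "\<lambda>x. x"] by auto
    then show "p \<in> ?R" using p primes_dvd_imp_eq by (auto simp: odd_primes_below_def less_Suc_eq_le)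
  qed
qed

lemma singular_series_primorial_upto:
  "prime q \<Longrightarrow> singular_series (primorial_upto q) =
     2 * twin_prime_const * prod sing_factor (odd_primes_below (Suc q))"
  by (simp add: singular_series_eq even_primorial_upto prime_divisors_primorial_upto)

lemma odd_primes_below_next_prime: "odd_primes_below (next_prime q) = odd_primes_below (Suc q)"
proof -
  have "p < next_prime q \<longleftrightarrow> p \<le> q" if "prime p" for p
    using next_prime(2)[of q] next_prime_le[OF that, of q] by (auto simp: not_less[symmetric])
  then show ?thesis by (auto simp: odd_primes_below_def less_Suc_eq_le)
qed

lemma prod_sing_factor_ge_1:
  assumes "\<And>p. p \<in> A \<Longrightarrow> p > 2"
  shows "prod sing_factor A \<ge> 1"
  using assms by (intro prod_ge_1) (auto intro!: less_imp_le sing_factor_gt_1)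

lemma singular_series_primorial_upto_ge:
  "prime q \<Longrightarrow> singular_series (primorial_upto q) \<ge> 2 * twin_prime_const"
  using prod_sing_factor_ge_1[of "odd_primes_below (Suc q)"] twin_prime_const_pos
  by (simp add: singular_series_primorial_upto odd_primes_below_def)

lemma card_odd_prime_divisors_le:
  assumes "prime q" "q > 2" "d > 0" "even d" "d < q * \<Prod>(primes_below q)"
  shows "card {p. prime p \<and> p dvd d \<and> p > 2} \<le> card (odd_primes_below q)"
proof -
  have "{p. prime p \<and> p dvd d} = insert 2 {p. prime p \<and> p dvd d \<and> p > 2}"
    using assms by (auto dest: prime_gt_1_nat)
  then have "card {p. prime p \<and> p dvd d} = Suc (card {p. prime p \<and> p dvd d \<and> p > 2})"
    using finite_prime_divisors[OF assms(3)] by simp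
  moreover have "card (primes_below q) = Suc (card (odd_primes_below q))"
    using assms by (simp add: primes_below_eq) (simp add: odd_primes_below_def)
  ultimately show ?thesis using card_prime_divisors_le[of q d] assms by linarith
qed

lemma singular_series_below_le:
  assumes "prime q" "q > 2" "d > 0" "d < q * \<Prod>(primes_below q)"
  shows "singular_series d \<le> 2 * twin_prime_const * prod sing_factor (odd_primes_below q)"
proof (cases "even d")
  case True
  have "prod sing_factor {p. prime p \<and> p dvd d \<and> p > 2} \<le> prod sing_factor (odd_primes_below q)"
    by (rule prod_sing_factor_exchange(1))
       (use assms card_odd_prime_divisors_le[OF assms(1-3) True] finite_prime_divisors[OF assms(3)] in auto)
  then show ?thesis using True twin_prime_const_pos by (simp add: singular_series_eq)
next
  case False
  then show ?thesis using twin_prime_const_pos prod_sing_factor_ge_1[of "odd_primes_below q"]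
    by (simp add: singular_series_def) (simp add: odd_primes_below_def)
qed

text \<open>A number below the primorial has too few prime factors to match it, so its product is
  bounded by that over the odd primes below \<open>q\<close>, where the factor at \<open>q\<close>
  is absent. This is the gain of about 1 + 1 / L.\<close>

lemma singular_series_less_primorial:
  assumes "prime q" "q > 2" "d > 0" "d < primorial_upto q"
  shows "singular_series d * sing_factor q \<le> singular_series (primorial_upto q)"
proof -
  have "odd_primes_below (Suc q) = insert q (odd_primes_below q)"
    using assms by (auto simp: odd_primes_below_def)
  then have "singular_series (primorial_upto q) =
    2 * twin_prime_const * prod sing_factor (odd_primes_below q) * sing_factor q"
    using assms by (simp add: singular_series_primorial_upto) (simp add: odd_primes_below_def)
  then show ?thesis
    using singular_series_below_le[of q d] assms sing_factor_gt_1[of q]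
    by (simp add: primorial_upto_prime)
qed

lemma singular_series_less_next_primorial:
  assumes "prime q" "d > 0" "d < next_prime q * primorial_upto q"
  shows "singular_series d \<le> singular_series (primorial_upto q)"
proof -
  have "2 < next_prime q" using next_prime(2)[of q] prime_ge_2_nat[OF assms(1)] by linarith
  then show ?thesis
    using singular_series_below_le[OF next_prime(1)[of q] _ assms(2)] assms
    by (simp add: prod_primes_below_next_prime singular_series_primorial_upto odd_primes_below_next_prime)
qed

lemma singular_series_primorial_next:
  assumes "prime q"
  shows "singular_series (primorial_upto (next_prime q)) =
     singular_series (primorial_upto q) * sing_factor (next_prime q)"
proof -
  have q2: "2 < next_prime q" using next_prime(2)[of q] prime_ge_2_nat[OF assms(1)] by linarith
  have "odd_primes_below (Suc (next_prime q)) = insert (next_prime q) (odd_primes_below (next_prime q))"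
    using q2 next_prime(1)[of q] by (auto simp: odd_primes_below_def)
  moreover have "next_prime q \<notin> odd_primes_below (next_prime q)" by (simp add: odd_primes_below_def)
  ultimately show ?thesis using assms next_prime(1)[of q]
    by (simp add: singular_series_primorial_upto odd_primes_below_next_prime)
qed

text \<open>An even non-multiple misses some odd prime up to \<open>q\<close>, which can at best be
  replaced by one from \<open>next_prime q\<close> on. The least possible loss swaps
  \<open>q\<close> for its successor.\<close>

lemma singular_series_non_multiple:
  assumes "prime q" "q > 2" "d > 0" "d < next_prime q * primorial_upto q" "\<not> primorial_upto q dvd d"
  shows "singular_series d \<le> singular_series (primorial_upto q) * (1 - 1 / (real (next_prime q))\<^sup>2)"
proof (cases "even d")
  case True
  let ?r = "next_prime q"
  let ?A = "{p. prime p \<and> p dvd d \<and> p > 2}"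
  have r: "prime ?r" "?r > 2" "q < ?r" using next_prime[of q] assms by auto
  have finA: "finite ?A" by (rule finite_prime_divisors[OF assms(3)])
  have "\<not> (\<forall>p\<in>{p. prime p \<and> p \<le> q}. p dvd d)"
    using assms(5) unfolding primorial_upto_def by (subst (asm) prod_primes_dvd_iff) auto
  then obtain p where p: "prime p" "p \<le> q" "\<not> p dvd d" by auto
  then have "p \<noteq> 2" using True by auto
  then have "p \<in> odd_primes_below ?r" using p r prime_ge_2_nat[OF p(1)] by (simp add: odd_primes_below_def)
  then have not_sub: "\<not> odd_primes_below ?r \<subseteq> ?A" using p by auto
  have card: "card ?A \<le> card (odd_primes_below ?r)"
    using assms r True by (intro card_odd_prime_divisors_le) (auto simp: prod_primes_below_next_prime)
  have "p \<le> q" if "prime p" "p < ?r" for p using next_prime_le[of p q] that by force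
  \<comment> \<open>The exchange lemma with \<open>next_prime q\<close> in the role of its
    \<open>q\<close>, and with the present \<open>q\<close>, the preceding prime, as its
    \<open>q0\<close>.\<close>
  then have "prod sing_factor ?A * sing_factor q \<le> prod sing_factor (odd_primes_below ?r) * sing_factor ?r"
    using prod_sing_factor_exchange(2)[OF finA _ card r(2) not_sub assms(2)] r by auto
  then have "singular_series d * sing_factor q \<le> singular_series (primorial_upto q) * sing_factor ?r"
    using assms True twin_prime_const_pos
    by (simp add: singular_series_eq singular_series_primorial_upto odd_primes_below_next_prime)
  moreover have "sing_factor ?r \<le> sing_factor q * (1 - 1 / (real ?r)\<^sup>2)"
  proof -
    define a b where "a = real q" and "b = real ?r"
    have ab: "a > 2" "b \<ge> a + 1" using assms r by (auto simp: a_def b_def)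
    \<comment> \<open>The relative drop between the two factors is exactly (b - a) / ((b - 2) (a -
      1)); a numerator of at least 1 and a denominator of at most b^2 leave 1 / b^2.\<close>
    have "(b - 1) / (b - 2) = (a - 1) / (a - 2) * (1 - (b - a) / ((b - 2) * (a - 1)))"
    proof -
      have "(b - 2) * (a - 1) - (b - a) = (b - 1) * (a - 2)" by (simp add: algebra_simps)
      moreover have "(b - 2) * (a - 1) > 0" using ab by simp
      ultimately have "1 - (b - a) / ((b - 2) * (a - 1)) = (b - 1) * (a - 2) / ((b - 2) * (a - 1))"
        by (metis diff_divide_distrib divide_self less_irrefl)
      then show ?thesis using ab by simp
    qed
    also have "\<dots> \<le> (a - 1) / (a - 2) * (1 - 1 / b\<^sup>2)"
    proof -
      have "(b - 2) * (a - 1) \<le> b * b" using ab by (intro mult_mono) auto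
      then have "1 / b\<^sup>2 \<le> 1 / ((b - 2) * (a - 1))"
        using ab by (intro divide_left_mono) (auto simp: power2_eq_square)
      also have "\<dots> \<le> (b - a) / ((b - 2) * (a - 1))"
        using ab by (intro divide_right_mono) auto
      finally show ?thesis using ab by (intro mult_left_mono) auto
    qed
    finally show ?thesis by (simp add: sing_factor_def a_def b_def)
  qed
  moreover have "singular_series (primorial_upto q) \<ge> 0"
    using singular_series_primorial_upto_ge[OF assms(1)] twin_prime_const_pos by linarith
  ultimately have "singular_series d * sing_factor q \<le>
     singular_series (primorial_upto q) * (sing_factor q * (1 - 1 / (real ?r)\<^sup>2))"
    by (meson mult_left_mono order_trans)
  then have "singular_series d * sing_factor q \<le>
     singular_series (primorial_upto q) * (1 - 1 / (real ?r)\<^sup>2) * sing_factor q"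
    by (simp add: mult_ac)
  then show ?thesis using sing_factor_gt_1[OF assms(2)] by simp
next
  case False
  have "(real (next_prime q))\<^sup>2 \<ge> 1" using prime_ge_1_nat[OF next_prime(1)[of q]] by simp
  then have "1 / (real (next_prime q))\<^sup>2 \<le> 1" by (rule divide_le_eq_1_pos[THEN iffD2, rotated]) (simp add: prime_gt_0_nat next_prime)
  then show ?thesis using False singular_series_primorial_upto_ge[OF assms(1)] twin_prime_const_pos
    by (auto simp: singular_series_def[of d] intro!: mult_nonneg_nonneg)
qed

text \<open>Prime factors of \<open>d\<close> above \<open>q\<close> are few since their product is at most $d$.\<close>

lemma singular_series_le_exp:
  assumes q: "prime q" "q > 3" and d: "d > 0" "real d \<le> x"
  shows "singular_series d \<le> singular_series (primorial_upto q) * exp (ln x / (ln (real q) * (real q - 2)))"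
proof (cases "even d")
  case True
  let ?A = "{p. prime p \<and> p dvd d \<and> p > 2}"
  let ?B = "odd_primes_below (Suc q)"
  have finA: "finite ?A" by (rule finite_prime_divisors[OF d(1)])
  define m where "m = card (?A - ?B)"
  have x1: "x \<ge> 1" using d by linarith
  have "\<Prod>(?A - ?B) dvd d" using finA by (subst prod_primes_dvd_iff) auto
  then have le: "\<Prod>(?A - ?B) \<le> d" using d by (intro dvd_imp_le) auto
  have "q ^ m \<le> \<Prod>(?A - ?B)" unfolding m_def
    by (subst prod_constant[symmetric], intro prod_mono) (auto simp: odd_primes_below_def)
  then have "q ^ m \<le> d" using le by linarith
  then have "real (q ^ m) \<le> real d" by (rule of_nat_mono)
  then have "real q ^ m \<le> x" using d by (simp only: of_nat_power)
  then have "ln (real q ^ m) \<le> ln x" using q by (subst ln_le_cancel_iff) (use x1 in auto)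
  then have m: "real m * ln (real q) \<le> ln x" using q by (simp add: ln_realpow)
  have lnq: "ln (real q) > 0" using q by simp
  have "prod sing_factor (?A - ?B) \<le> sing_factor q ^ m"
    unfolding m_def
  proof (intro prod_le_power)
    show "0 \<le> sing_factor p \<and> sing_factor p \<le> sing_factor q" if "p \<in> ?A - ?B" for p
      using that q sing_factor_gt_1[of p] by (auto simp: odd_primes_below_def intro!: sing_factor_antimono)
  qed (use sing_factor_gt_1[of q] q in auto)
  also have "\<dots> \<le> exp (1 / (real q - 2)) ^ m"
    using sing_factor_gt_1[of q] q by (intro power_mono) (auto simp: sing_factor_eq exp_ge_add_one_self)
  also have "\<dots> = exp (real m / (real q - 2))" by (simp add: exp_of_nat_mult[symmetric])
  also have "\<dots> \<le> exp (ln x / (ln (real q) * (real q - 2)))"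
  proof -
    have "real m \<le> ln x / ln (real q)" using m lnq by (simp add: le_divide_eq)
    then have "real m / (real q - 2) \<le> ln x / ln (real q) / (real q - 2)" using q by (intro divide_right_mono) auto
    then show ?thesis by simp
  qed
  finally have 1: "prod sing_factor (?A - ?B) \<le> exp (ln x / (ln (real q) * (real q - 2)))" .
  have "prod sing_factor (?A \<inter> ?B) \<le> prod sing_factor ?B"
    by (rule prod_mono2)
       (auto simp: odd_primes_below_def intro!: less_imp_le sing_factor_gt_1 order_trans[OF zero_le_one])
  then have "prod sing_factor (?A \<inter> ?B) * prod sing_factor (?A - ?B) \<le>
     prod sing_factor ?B * exp (ln x / (ln (real q) * (real q - 2)))"
    using 1 prod_sing_factor_ge_1[of "?A - ?B"] prod_sing_factor_ge_1[of ?B]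
    by (intro mult_mono) (auto simp: odd_primes_below_def)
  then have "prod sing_factor ?A \<le> prod sing_factor ?B * exp (ln x / (ln (real q) * (real q - 2)))"
    unfolding prod.Int_Diff[OF finA, of sing_factor ?B] .
  then have "2 * twin_prime_const * prod sing_factor ?A \<le> 2 * twin_prime_const * (prod sing_factor ?B * exp (ln x / (ln (real q) * (real q - 2))))"
    using twin_prime_const_pos by (intro mult_left_mono) auto
  then show ?thesis
    using True q by (simp add: singular_series_eq[OF True] singular_series_primorial_upto mult.assoc)
next
  case False
  then show ?thesis using singular_series_primorial_upto_ge[OF q(1)] twin_prime_const_pos
    by (simp add: singular_series_def[of d])
qed

text \<open>Connects the indexing by the largest prime factor with the enumeration. Since
  \<open>nth_prime\<close> counts from one and \<open>enumerate\<close> from zero,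
  \<open>primorial (Suc k)\<close> ends with the prime of enumeration index k.\<close>

lemma is_primorial_iff: "is_primorial n \<longleftrightarrow> (\<exists>q. prime q \<and> n = primorial_upto q)"
proof -
  let ?e = "enumerate {p :: nat. prime p}"
  have inf: "infinite {p :: nat. prime p}" by (rule primes_infinite)
  have prim: "primorial (Suc k) = primorial_upto (?e k)" for k
  proof -
    have "primorial (Suc k) = (\<Prod>j=1..Suc k. ?e (j - 1))"
      by (simp only: primorial_def nth_prime_def)
    also have "\<dots> = (\<Prod>j\<in>{..k}. ?e j)"
      by (rule prod.reindex_bij_witness[of _ Suc "\<lambda>j. j - 1"]) auto
    also have "\<dots> = \<Prod>(?e ` {..k})"
      using inj_enumerate[OF inf] by (subst prod.reindex) (auto simp: inj_on_def inj_def)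
    also have "?e ` {..k} = {p. prime p \<and> p \<le> ?e k}"
    proof (intro set_eqI iffI)
      fix p assume "p \<in> ?e ` {..k}"
      then show "p \<in> {p. prime p \<and> p \<le> ?e k}"
        using enumerate_in_set[OF inf] enumerate_mono_le_iff[OF inf] by auto
    next
      fix p assume p: "p \<in> {p. prime p \<and> p \<le> ?e k}"
      then obtain j where "p = ?e j" using enumerate_Ex[of "{p. prime p}" p] inf by auto
      then show "p \<in> ?e ` {..k}" using p enumerate_mono_le_iff[OF inf] by auto
    qed
    finally show ?thesis by (simp add: primorial_upto_def)
  qed
  show ?thesis
  proof
    assume "is_primorial n"
    then obtain k where "k \<ge> 1" "n = primorial k" by (auto simp: is_primorial_def)
    then have "n = primorial_upto (?e (k - 1))" using prim[of "k - 1"] by simp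
    moreover have "prime (?e (k - 1))" using enumerate_in_set[OF inf, of "k - 1"] by simp
    ultimately show "\<exists>q. prime q \<and> n = primorial_upto q" by blast
  next
    assume "\<exists>q. prime q \<and> n = primorial_upto q"
    then obtain q where q: "prime q" "n = primorial_upto q" by blast
    then obtain k where "q = ?e k" using enumerate_Ex[of "{p. prime p}" q] inf by auto
    then have "n = primorial (Suc k)" using q prim by simp
    then show "is_primorial n" by (auto simp: is_primorial_def)
  qed
qed

section \<open>Primorials and integrals near x\<close>

lemma chebyshev_theta_eq_ln_primorial: "chebyshev_theta (real q) = ln (real (primorial_upto q))"
proof -
  have "finite {p. prime p \<and> p \<le> q}" by simp
  then have "ln (\<Prod>p\<in>{p. prime p \<and> p \<le> q}. real p) = (\<Sum>p\<in>{p. prime p \<and> p \<le> q}. ln (real p))"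
    by (intro ln_prod) (auto simp: prime_gt_0_nat)
  then show ?thesis by (simp add: chebyshev_theta_def primorial_upto_def)
qed

lemma next_prime_mono: "q \<le> r \<Longrightarrow> next_prime q \<le> next_prime r"
  using next_prime[of r] by (intro next_prime_le) auto

text \<open>The logarithm of a primorial is theta of its largest prime, hence asymptotic to that
  prime. The upper size condition on the primorial bounds \<open>q\<close> above, the lower one on
  its successor bounds \<open>q\<close> below, up to terms of order ln L.\<close>

lemma eventually_primorial_primes:
  assumes HL: hardy_littlewood_hypothesis and \<eta>: "0 < \<eta>" "\<eta> < 1"
  shows "\<forall>\<^sub>F x in at_top. \<forall>q. prime q \<and> real (primorial_upto q) \<le> 2 * x \<and>
      x / (ln x)\<^sup>2 \<le> real (primorial_upto (next_prime q)) \<longrightarrow>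
      (1 - \<eta>) * ln x \<le> real q \<and> real (next_prime q) \<le> (1 + \<eta>) * ln x"
proof -
  \<comment> \<open>A quarter suffices for (1 + \<open>\<theta>\<close>) / (1 -
    \<open>\<theta>\<close>) < 1 + \<open>\<eta>\<close> and (1 - \<open>\<eta>\<close>) (1 +
    \<open>\<theta>\<close>) < 1. The resulting slacks \<open>\<kappa>\<close> and
    \<open>\<mu>\<close> absorb the lower order terms.\<close>
  define \<theta> where "\<theta> = \<eta> / 4"
  have \<theta>: "0 < \<theta>" "\<theta> < 1 / 4" using \<eta> by (auto simp: \<theta>_def)
  have "\<forall>\<^sub>F y in at_top. \<bar>chebyshev_theta y / y - 1\<bar> < \<theta>"
    using tendstoD[OF chebyshev_theta_asymp[OF HL] \<theta>(1)] by (simp add: dist_real_def)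
  then have "\<forall>\<^sub>F y in at_top. \<bar>chebyshev_theta y / y - 1\<bar> < \<theta> \<and>
      (\<exists>p. prime p \<and> y < real p \<and> real p \<le> (1 + \<theta>) * y)"
    using eventually_prime_in[OF HL \<theta>(1)] by eventually_elim blast
  then obtain Y where Y: "\<And>y. y \<ge> Y \<Longrightarrow> \<bar>chebyshev_theta y / y - 1\<bar> < \<theta> \<and>
      (\<exists>p. prime p \<and> y < real p \<and> real p \<le> (1 + \<theta>) * y)"
    by (auto simp: eventually_at_top_linorder)
  obtain N where N: "real N > Y" using reals_Archimedean2 by blast
  define K where "K = real (primorial_upto (next_prime N))"
  define \<kappa> where "\<kappa> = 1 + \<eta> - (1 + \<theta>) / (1 - \<theta>)"
  have \<kappa>: "\<kappa> > 0"
  proof -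
    have "(1 + \<eta>) * (1 - \<theta>) - (1 + \<theta>) = \<eta> / 2 - \<eta> * \<eta> / 4" by (simp add: \<theta>_def field_simps)
    moreover have "\<eta> * \<eta> < \<eta> * 1" using \<eta> by (intro mult_strict_left_mono) auto
    ultimately have "(1 + \<eta>) * (1 - \<theta>) > 1 + \<theta>" using \<eta> by linarith
    then show ?thesis using \<theta> by (simp add: \<kappa>_def divide_less_eq)
  qed
  define \<mu> where "\<mu> = 1 - (1 - \<eta>) * (1 + \<theta>)"
  have \<mu>: "\<mu> > 0"
  proof -
    have "\<mu> = \<eta> * 3 / 4 + \<eta> * \<eta> / 4" by (simp add: \<mu>_def \<theta>_def field_simps)
    then show ?thesis using \<eta> by (simp add: add_pos_pos)
  qed
  have "\<forall>\<^sub>F x in at_top. K < x / (ln x)\<^sup>2" by real_asymp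
  moreover have "\<forall>\<^sub>F x in at_top. (1 + \<theta>) / (1 - \<theta>) * ln 2 \<le> \<kappa> * ln x" using \<kappa> by real_asymp
  moreover have "\<forall>\<^sub>F x in at_top. 2 * ln (ln x) + ln ((1 + \<eta>) * ln x) \<le> \<mu> * ln x" using \<mu> \<eta> by real_asymp
  moreover have "\<forall>\<^sub>F x in at_top. x > exp (1 :: real)" by (rule eventually_gt_at_top)
  ultimately show ?thesis
  proof eventually_elim
    case (elim x)
    show ?case
    proof (intro allI impI, elim conjE)
      fix q assume q: "prime q" "real (primorial_upto q) \<le> 2 * x"
        "x / (ln x)\<^sup>2 \<le> real (primorial_upto (next_prime q))"
      have "exp 1 > (0 :: real)" by simp
      then have x0: "x > 0" using elim by linarith
      have "ln (exp 1) < ln x" using elim x0 by (subst ln_less_cancel_iff) auto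
      then have L: "ln x > 1" by simp
      \<comment> \<open>Were \<open>q\<close> at most \<open>N\<close>, the next primorial would be
        at most the fixed number \<open>K\<close>, contradicting its lower bound x / L^2. So the
        asymptotics of theta apply at \<open>q\<close>.\<close>
      have qN: "q > N"
      proof (rule ccontr)
        assume "\<not> q > N"
        then have "primorial_upto (next_prime q) \<le> primorial_upto (next_prime N)"
          by (intro primorial_upto_mono next_prime_mono) auto
        then show False using q elim by (simp add: K_def)
      qed
      then have qpos: "real q > 0" and qY: "real q \<ge> Y" using N by auto
      define T where "T = ln (real (primorial_upto q))"
      have "\<bar>T / real q - 1\<bar> < \<theta>" using Y[OF qY] by (simp add: T_def chebyshev_theta_eq_ln_primorial)
      then have "T / real q < 1 + \<theta>" "T / real q > 1 - \<theta>" by linarith+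
      then have T: "T \<le> (1 + \<theta>) * real q" "(1 - \<theta>) * real q \<le> T"
        using qpos by (auto simp: divide_less_eq less_divide_eq)
      obtain p where "prime p" "real q < real p" "real p \<le> (1 + \<theta>) * real q" using Y[OF qY] by blast
      then have r: "real (next_prime q) \<le> (1 + \<theta>) * real q"
        using next_prime_le[of p q] by linarith
      have Ppos: "real (primorial_upto q) > 0" using primorial_upto_pos by simp
      then have "T \<le> ln (2 * x)" unfolding T_def using q x0 by (subst ln_le_cancel_iff) auto
      then have "T \<le> ln 2 + ln x" using x0 by (simp add: ln_mult)
      then have "real q \<le> (ln 2 + ln x) / (1 - \<theta>)" using T \<theta> by (simp add: le_divide_eq mult.commute)
      then have "(1 + \<theta>) * real q \<le> (1 + \<theta>) * ((ln 2 + ln x) / (1 - \<theta>))" using \<theta> by (intro mult_left_mono) auto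
      also have "\<dots> = (1 + \<theta>) / (1 - \<theta>) * ln 2 + (1 + \<theta>) / (1 - \<theta>) * ln x" by (simp add: distrib_left add_divide_distrib[of "ln 2"])
      also have "\<dots> \<le> \<kappa> * ln x + (1 + \<theta>) / (1 - \<theta>) * ln x" using elim by simp
      also have "\<dots> = (1 + \<eta>) * ln x" unfolding \<kappa>_def by (simp add: algebra_simps)
      finally have up: "real (next_prime q) \<le> (1 + \<eta>) * ln x" using r by linarith
      have rpos: "real (next_prime q) > 0" using next_prime(1)[of q] by (simp add: prime_gt_0_nat)
      have "ln x - 2 * ln (ln x) = ln (x / (ln x)\<^sup>2)" using x0 L by (simp add: ln_div ln_realpow)
      also have "\<dots> \<le> ln (real (primorial_upto (next_prime q)))"
      proof (subst ln_le_cancel_iff)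
        show "0 < x / (ln x)\<^sup>2" using x0 L by (intro divide_pos_pos) auto
        then show "0 < real (primorial_upto (next_prime q))" using q(3) by linarith
      qed (use q in auto)
      also have "\<dots> = ln (real (next_prime q)) + T"
        unfolding primorial_upto_next T_def of_nat_mult using rpos Ppos by (subst ln_mult) auto
      also have "ln (real (next_prime q)) \<le> ln ((1 + \<eta>) * ln x)"
        using up rpos L \<eta> by (subst ln_le_cancel_iff) auto
      finally have "ln x - 2 * ln (ln x) \<le> ln ((1 + \<eta>) * ln x) + (1 + \<theta>) * real q" using T by linarith
      then have "(1 - \<eta>) * (1 + \<theta>) * ln x \<le> (1 + \<theta>) * real q"
        using elim unfolding \<mu>_def by (simp add: algebra_simps)
      then have "(1 + \<theta>) * ((1 - \<eta>) * ln x) \<le> (1 + \<theta>) * real q" by (simp add: mult_ac)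
      then have "(1 - \<eta>) * ln x \<le> real q" using \<theta> by (subst (asm) mult_le_cancel_left_pos) auto
      then show "(1 - \<eta>) * ln x \<le> real q \<and> real (next_prime q) \<le> (1 + \<eta>) * ln x" using up by blast
    qed
  qed
qed

section \<open>Bounds for the pair integral\<close>

definition li2 :: "real \<Rightarrow> real" where
  "li2 y = integral {2..y} (\<lambda>t. 1 / (ln t)\<^sup>2)"

lemma integrable_li2: "a > 1 \<Longrightarrow> (\<lambda>t. 1 / (ln t :: real)\<^sup>2) integrable_on {a..b}"
  by (rule integrable_continuous_real) (auto intro!: continuous_intros)

lemma li2_nonneg: "li2 y \<ge> 0"
  unfolding li2_def by (rule integral_nonneg[OF integrable_li2]) auto

lemma li2_split: "2 \<le> a \<Longrightarrow> a \<le> b \<Longrightarrow> li2 b = li2 a + integral {a..b} (\<lambda>t. 1 / (ln t)\<^sup>2)"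
  unfolding li2_def
  by (intro Henstock_Kurzweil_Integration.integral_combine[symmetric] integrable_li2) auto

text \<open>Holds on all reals because the integral over an empty interval is 0.\<close>

lemma li2_mono: "a \<le> b \<Longrightarrow> li2 a \<le> li2 b"
  unfolding li2_def by (rule integral_subset_le) (auto intro!: integrable_li2)

lemma li2_integral_le:
  fixes u v :: real
  assumes "1 < u" "u \<le> v"
  shows "integral {u..v} (\<lambda>t. 1 / (ln t)\<^sup>2) \<le> (v - u) / (ln u)\<^sup>2"
proof -
  have "integral {u..v} (\<lambda>t. 1 / (ln t)\<^sup>2) \<le> integral {u..v} (\<lambda>t. 1 / (ln u)\<^sup>2)"
    using assms by (intro integral_le integrable_li2)
      (auto intro!: divide_left_mono power_mono mult_pos_pos zero_less_power)
  then show ?thesis using assms by simp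
qed

text \<open>Split at y / L^3 with L = ln y: below it a constant bound on the integrand contributes
  O(y / L^3), above it the logarithm is already asymptotic to L.\<close>

lemma eventually_li2_le:
  assumes "\<eta> > 0"
  shows "\<forall>\<^sub>F y in at_top. li2 y \<le> (1 + \<eta>) * y / (ln y)\<^sup>2"
proof -
  have "((\<lambda>y :: real. (y / ln y ^ 3 / (ln 2)\<^sup>2 + y / (ln (y / ln y ^ 3))\<^sup>2) / (y / (ln y)\<^sup>2)) \<longlongrightarrow> 1) at_top"
    by real_asymp
  then have "\<forall>\<^sub>F y in at_top. (y / ln y ^ 3 / (ln 2)\<^sup>2 + y / (ln (y / ln y ^ 3))\<^sup>2) / (y / (ln y)\<^sup>2) < 1 + \<eta>"
    by (rule order_tendstoD) (use assms in auto)
  moreover have "\<forall>\<^sub>F y in at_top. y / ln y ^ 3 \<ge> (2::real)" "\<forall>\<^sub>F y in at_top. y / ln y ^ 3 \<le> (y::real)"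
    by real_asymp+
  ultimately show ?thesis using eventually_gt_at_top[of 3]
  proof eventually_elim
    case (elim y)
    let ?T = "y / ln y ^ 3"
    have "li2 y = li2 ?T + integral {?T..y} (\<lambda>t. 1 / (ln t)\<^sup>2)" using elim by (intro li2_split) linarith+
    also have "li2 ?T \<le> (?T - 2) / (ln 2)\<^sup>2" unfolding li2_def using elim by (intro li2_integral_le) linarith+
    also have "\<dots> \<le> ?T / (ln 2)\<^sup>2" by (intro divide_right_mono) auto
    also have "integral {?T..y} (\<lambda>t. 1 / (ln t)\<^sup>2) \<le> (y - ?T) / (ln ?T)\<^sup>2" using elim by (intro li2_integral_le) linarith+
    also have "\<dots> \<le> y / (ln ?T)\<^sup>2" using elim by (intro divide_right_mono) auto
    finally have "li2 y \<le> ?T / (ln 2)\<^sup>2 + y / (ln ?T)\<^sup>2" by simp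
    moreover have "y / (ln y)\<^sup>2 > 0" using elim by auto
    then have "?T / (ln 2)\<^sup>2 + y / (ln ?T)\<^sup>2 \<le> (1 + \<eta>) * (y / (ln y)\<^sup>2)"
      using elim(1) less_imp_le by (simp only: divide_less_eq split: if_splits) auto
    ultimately show ?case by simp
  qed
qed

lemma pair_integral_le_li2: "pair_integral x d \<le> li2 (x - real d)"
  unfolding pair_integral_def li2_def
  by (intro integral_le integrable_pair_integrand integrable_li2)
     (auto simp: power2_eq_square intro!: divide_left_mono mult_mono mult_pos_pos)

lemma pair_integral_nonneg: "pair_integral x d \<ge> 0"
  unfolding pair_integral_def by (intro integral_nonneg integrable_pair_integrand) auto

lemma pair_integral_ge:
  assumes "2 \<le> x - real d"
  shows "pair_integral x d \<ge> (x - real d - 2) / (ln x)\<^sup>2"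
  unfolding pair_integral_def using assms by (intro pair_integrand_integral_ge) auto

text \<open>A larger difference both shortens the range and lowers the integrand; only the
  shortening is kept, and on the removed piece the integrand is at least 1 / (ln x)^2.\<close>

lemma pair_integral_diff_ge:
  assumes "d \<le> d'" "2 \<le> x - real d'"
  shows "pair_integral x d - pair_integral x d' \<ge> (real d' - real d) / (ln x)\<^sup>2"
proof -
  let ?f = "\<lambda>d t. 1 / (ln t * ln (t + real d))"
  have "pair_integral x d = integral {2..x - real d'} (?f d) + integral {x - real d'..x - real d} (?f d)"
    unfolding pair_integral_def using assms
    by (intro Henstock_Kurzweil_Integration.integral_combine[symmetric] integrable_pair_integrand) auto
  moreover have "integral {2..x - real d'} (?f d) \<ge> pair_integral x d'"
    unfolding pair_integral_def using assms
    by (intro integral_le integrable_pair_integrand) (auto intro!: divide_left_mono mult_mono mult_pos_pos)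
  moreover have "integral {x - real d'..x - real d} (?f d) \<ge> (x - real d - (x - real d')) / (ln x)\<^sup>2"
    using assms by (intro pair_integrand_integral_ge) auto
  ultimately show ?thesis by simp
qed

text \<open>The integral for \<open>d\<close> is at most \<open>li2 x\<close>. In the one for
  \<open>d'\<close>, replacing both logarithms by \<open>ln (t + real d')\<close> and shifting the
  variable gives \<open>li2 x\<close> without its initial piece up to 2 + d'.\<close>

lemma pair_integral_diff_le:
  assumes "2 \<le> x - real d'"
  shows "pair_integral x d - pair_integral x d' \<le> li2 (2 + real d')"
proof -
  have shift: "((\<lambda>t. 1 / (ln (t + real d'))\<^sup>2) has_integral integral {2 + real d'..x} (\<lambda>t. 1 / (ln t)\<^sup>2)) {2..x - real d'}"
  proof -
    have "((\<lambda>t. 1 / (ln t)\<^sup>2) has_integral integral {2 + real d'..x} (\<lambda>t. 1 / (ln t)\<^sup>2)) (cbox (2 + real d') x)"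
      using integrable_integral[OF integrable_li2[of "2 + real d'" x]] by simp
    from has_integral_affinity[OF this, of 1 "real d'"] show ?thesis
      by (simp add: algebra_simps image_diff_atLeastAtMost cbox_interval)
  qed
  have "integral {2..x - real d'} (\<lambda>t. 1 / (ln (t + real d'))\<^sup>2) \<le> pair_integral x d'"
    unfolding pair_integral_def using assms
    by (intro integral_le integrable_pair_integrand has_integral_integrable[OF shift])
       (auto simp: power2_eq_square intro!: divide_left_mono mult_mono mult_pos_pos)
  then have "integral {2 + real d'..x} (\<lambda>t. 1 / (ln t)\<^sup>2) \<le> pair_integral x d'"
    using integral_unique[OF shift] by simp
  moreover have "li2 x = li2 (2 + real d') + integral {2 + real d'..x} (\<lambda>t. 1 / (ln t)\<^sup>2)"
    using assms by (intro li2_split) auto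
  moreover have "pair_integral x d \<le> li2 x"
    using pair_integral_le_li2[of x d] li2_mono[of "x - real d" x] by linarith
  ultimately show ?thesis by linarith
qed

section \<open>Comparing the pair counts\<close>

text \<open>The hypothesis starts at d = 2, so difference 1 is settled by parity: the only possible
  pair is (2, 3).\<close>

lemma prime_pair_count_1_le: "prime_pair_count x 1 \<le> 1"
proof -
  have "p = 2" if "prime p" "prime (p + 1)" for p :: nat
  proof (rule ccontr)
    assume "p \<noteq> 2"
    then have "odd p" using that prime_odd_nat[of p] prime_ge_2_nat[of p] by force
    then have "even (p + 1)" by simp
    moreover have "p + 1 > 2" using prime_ge_2_nat[OF that(1)] by simp
    ultimately show False using prime_odd_nat[OF that(2)] by blast
  qed
  then have "card {p. prime p \<and> prime (p + 1) \<and> real (p + 1) \<le> x} \<le> card {2 :: nat}"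
    by (intro card_mono) auto
  then show ?thesis unfolding prime_pair_count_eq by simp
qed

lemma prime_pair_count_eq_0: "real d > x \<Longrightarrow> prime_pair_count x d = 0"
  unfolding prime_pair_count_eq by (auto simp: card_eq_0_iff)

text \<open>Freezes x: every demand that x be large becomes an assumption, and the comparisons turn
  into plain inequalities. The constants fit together as follows: the two error terms of a
  comparison add up to 1 / 8 of \<open>twin_prime_const * (x / ln x ^ 4)\<close>, half of the gain
  secured in \<open>count_less\<close>, and the 16 in \<open>x_large\<close> covers difference
  1.\<close>

locale champion_range =
  fixes \<delta> x :: real
  assumes \<delta>: "0 < \<delta>" "\<delta> \<le> 1 / 4"
    and ln_large: "ln x \<ge> 1000 / \<delta>"
    and hl: "\<And>d. 2 \<le> d \<Longrightarrow> real d \<le> 8 / 9 * x \<Longrightarrow>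
      \<bar>real (prime_pair_count x d) - singular_series d * pair_integral x d\<bar>
        \<le> twin_prime_const / 16 * (x / ln x ^ 4)"
    and hl_beyond: "\<And>d. 8 / 9 * x < real d \<Longrightarrow> real d \<le> x \<Longrightarrow>
      real (prime_pair_count x d) \<le> singular_series d * li2 (x / 2) + twin_prime_const / 8 * (x / ln x ^ 4)"
    and primes: "\<And>q. prime q \<Longrightarrow> real (primorial_upto q) \<le> 2 * x \<Longrightarrow>
      x / (ln x)\<^sup>2 \<le> real (primorial_upto (next_prime q)) \<Longrightarrow>
      (1 - \<delta> / 64) * ln x \<le> real q \<and> real (next_prime q) \<le> (1 + \<delta> / 64) * ln x"
    and exp_small: "exp (ln x / (ln ((1 - \<delta> / 64) * ln x) * ((1 - \<delta> / 64) * ln x - 2))) \<le> 11 / 10"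
    and li2_full: "li2 x \<le> (1 + \<delta> / 64) * (x / (ln x)\<^sup>2)"
    and li2_half: "li2 (x / 2) \<le> 3 / 5 * (x / (ln x)\<^sup>2)"
    and li2_start: "li2 (2 + (1 - \<delta> / 2) * (x / ln x)) \<le> (1 - \<delta> / 4) * (x / ln x ^ 3)"
    and primorial_small: "(1 + \<delta>) * (x / ln x) + 2 \<le> \<delta> / 64 * x"
    and x_large: "twin_prime_const * (x / ln x ^ 4) \<ge> 16"
begin

definition "L = ln x"
text \<open>Besides being the lower threshold, this is the size of the pair integral at a small
  difference. In terms of it x is \<open>U * L\<^sup>2\<close> and the hypothesis error has scale
  \<open>U / L\<^sup>2\<close>, so only powers of \<open>L\<close> are compared.\<close>

definition "U = x / (ln x)\<^sup>2"
definition "\<eta> = \<delta> / 64"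

lemma \<eta>: "0 < \<eta>" "\<eta> \<le> 1 / 256" "\<delta> = 64 * \<eta>"
  using \<delta> by (auto simp: \<eta>_def)

lemma quarter_\<delta>: "\<delta> / 4 = 16 * \<eta>"
  by (simp add: \<eta>_def)

lemma \<eta>L: "\<eta> * L \<ge> 15"
  using ln_large \<delta> by (simp add: \<eta>_def L_def field_simps)

lemma L_large: "L \<ge> 3840"
proof -
  have "\<eta> * L \<le> 1 / 256 * L"
  proof (cases "L \<ge> 0")
    case True
    then show ?thesis using \<eta> by (intro mult_right_mono) auto
  next
    case False
    then have "\<eta> * L \<le> 0" using \<eta> by (simp add: mult_le_0_iff)
    then show ?thesis using \<eta>L by linarith
  qed
  then show ?thesis using \<eta>L by linarith
qed

lemma x_pos: "x > 0"
proof (rule ccontr)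
  assume "\<not> x > 0"
  then have "x / ln x ^ 4 \<le> 0" by (intro divide_nonpos_nonneg) auto
  then have "twin_prime_const * (x / ln x ^ 4) \<le> 0" using twin_prime_const_pos by (simp only: mult_le_0_iff) simp
  then show False using x_large by linarith
qed

lemma scaled:
  "x / (ln x)\<^sup>2 = U" "x / ln x = U * L" "x / ln x ^ 3 = U / L" "x / ln x ^ 4 = U / L\<^sup>2"
  using x_pos L_large by (auto simp: U_def L_def field_simps power2_eq_square power3_eq_cube power4_eq_xxxx)

lemma x_eq: "x = U * L\<^sup>2"
  using L_large by (simp add: U_def L_def)

lemma U_pos: "U > 0"
  unfolding U_def using x_pos L_large by (intro divide_pos_pos) (auto simp: L_def)

text \<open>Wider than the interval of the theorem on both sides, so that it also covers the two
  primorials competing when that interval is empty.\<close>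

definition in_range :: "nat \<Rightarrow> bool" where
  "in_range q \<longleftrightarrow> prime q \<and> (1 - \<delta>) * U \<le> real (primorial_upto q) \<and>
     real (primorial_upto q) \<le> (1 + \<delta>) * (U * L)"

context
  fixes q :: nat
  assumes q: "in_range q"
begin

lemma prime_q: "prime q" using q by (simp add: in_range_def)

abbreviation "P \<equiv> primorial_upto q"
abbreviation "q' \<equiv> next_prime q"
abbreviation "S \<equiv> singular_series P"

lemma P_bounds: "3 / 4 * U \<le> real P" "real P + 2 \<le> \<eta> * x"
proof -
  have "3 / 4 * U \<le> (1 - \<delta>) * U" using \<delta> U_pos by (intro mult_right_mono) auto
  then show "3 / 4 * U \<le> real P" using q by (simp add: in_range_def)
  show "real P + 2 \<le> \<eta> * x" using q primorial_small
    unfolding scaled(2) \<eta>_def in_range_def by linarith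
qed

lemma P_le_x: "real P + 2 \<le> x / 256"
proof -
  have "\<eta> * x \<le> 1 / 256 * x" using \<eta> x_pos by (intro mult_right_mono) auto
  then show ?thesis using P_bounds by linarith
qed

lemma q_bounds: "(1 - \<eta>) * L \<le> real q" "real q' \<le> (1 + \<eta>) * L" "q < q'"
proof -
  show "q < q'" by (rule next_prime)
  \<comment> \<open>The successor of \<open>P\<close> is at least 3 P, hence at least 9 / 4 U, which
    meets the lower size condition of \<open>primes\<close>.\<close>
  have "q' \<ge> 3" using next_prime(2)[of q] prime_ge_2_nat[OF prime_q] by linarith
  then have "3 * real P \<le> real q' * real P" by (intro mult_right_mono) auto
  then have "x / (ln x)\<^sup>2 \<le> real (primorial_upto q')"
    unfolding primorial_upto_next scaled of_nat_mult using P_bounds U_pos by linarith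
  moreover have "real P \<le> 2 * x" using P_le_x x_pos by linarith
  ultimately show "(1 - \<eta>) * L \<le> real q" "real q' \<le> (1 + \<eta>) * L"
    using primes[OF prime_q] by (auto simp: L_def \<eta>_def)
qed

lemma q_large: "real q \<ge> 3000" "real q' \<ge> (1 - \<eta>) * L"
proof -
  have "(1 - \<eta>) * L \<ge> (1 - 1 / 256) * 3840" using \<eta> L_large by (intro mult_mono) auto
  then have "(1 - \<eta>) * L \<ge> 3825" by simp
  then show "real q \<ge> 3000" using q_bounds by linarith
  show "real q' \<ge> (1 - \<eta>) * L" using q_bounds by linarith
qed

lemma q_gt_2: "q > 2" using q_large by linarith

lemma S_ge: "S \<ge> 2 * twin_prime_const"
  by (rule singular_series_primorial_upto_ge[OF prime_q])

lemma S_pos: "S > 0"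
  using S_ge twin_prime_const_pos by linarith

lemma integral_P_ge: "pair_integral x P \<ge> (1 - \<eta>) * U"
proof -
  have "(1 - \<eta>) * U = (x - \<eta> * x) / (ln x)\<^sup>2" by (simp add: U_def algebra_simps diff_divide_distrib)
  also have "\<dots> \<le> (x - real P - 2) / (ln x)\<^sup>2" using P_bounds by (intro divide_right_mono) auto
  also have "\<dots> \<le> pair_integral x P" using P_le_x x_pos by (intro pair_integral_ge) linarith
  finally show ?thesis .
qed

lemma P_ge_2: "P \<ge> 2"
  using even_primorial_upto[OF prime_q] primorial_upto_pos[of q] by (auto elim!: evenE)

lemma count_P_ge: "real (prime_pair_count x P) \<ge> S * pair_integral x P - twin_prime_const / 16 * (U / L\<^sup>2)"
proof -
  have "real P \<le> 8 / 9 * x" using P_le_x x_pos by linarith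
  then show ?thesis using hl[OF P_ge_2] unfolding scaled(4) by linarith
qed

text \<open>Since \<open>S\<close> is at least \<open>2 * twin_prime_const\<close>, a main-term gain
  of 1 / 8 of \<open>S * (U / L\<^sup>2)\<close> exceeds both hypothesis errors. All comparisons up
  to x / 2 are reduced to this criterion.\<close>

lemma count_less:
  assumes d: "d > 0" "real d \<le> 8 / 9 * x"
    and gain: "S * pair_integral x P - singular_series d * pair_integral x d \<ge> S * (U / L\<^sup>2 / 8)"
  shows "prime_pair_count x d < prime_pair_count x P"
proof -
  define w where "w = U / L\<^sup>2"
  have w: "w > 0" using U_pos L_large by (simp add: w_def)
  have Cw: "twin_prime_const * w \<ge> 16" using x_large unfolding scaled(4) w_def .
  have "2 * twin_prime_const * (w / 8) \<le> S * (w / 8)" using S_ge w by (intro mult_right_mono) auto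
  then have Sw: "S * (w / 8) \<ge> twin_prime_const * w / 4" by simp
  have "real (prime_pair_count x d) < real (prime_pair_count x P)"
  proof (cases "d = 1")
    case True
    have "real (prime_pair_count x d) \<le> 1" using prime_pair_count_1_le[of x] True by simp
    moreover have "singular_series d = 0" using True by (simp add: singular_series_def)
    ultimately show ?thesis using gain count_P_ge Sw Cw unfolding w_def[symmetric] by simp
  next
    case False
    then have "2 \<le> d" using d by simp
    from hl[OF this d(2)] show ?thesis
      using gain count_P_ge Sw Cw unfolding scaled(4) w_def[symmetric] by linarith
  qed
  then show ?thesis by simp
qed

text \<open>Near the crossovers the margins are of order \<open>\<eta> * (U / L)\<close>; this
  converts them to the scale required by \<open>count_less\<close>.\<close>

lemma lower_order: "\<eta> * (U / L) \<ge> 15 * (U / L\<^sup>2)"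
proof -
  have "15 * (U / L\<^sup>2) \<le> (\<eta> * L) * (U / L\<^sup>2)" using \<eta>L U_pos by (intro mult_right_mono) auto
  also have "\<dots> = \<eta> * (U / L)" using L_large by (simp add: power2_eq_square)
  finally show ?thesis .
qed

text \<open>A smaller \<open>d\<close> lacks at least the factor \<open>f\<close> at
  \<open>q\<close> and gains at most \<open>l\<close> in the integral. The bound on \<open>P\<close>
  keeps \<open>l\<close> below (1 - 16 \<open>\<eta>\<close>) U / L, whereas the missing factor is
  worth about U / L.\<close>

lemma below_loses:
  assumes P: "real P \<le> (1 - \<delta> / 2) * (U * L)" and d: "0 < d" "d < P"
  shows "prime_pair_count x d < prime_pair_count x P"
proof (rule count_less)
  show "real d \<le> 8 / 9 * x" using d P_le_x x_pos by linarith
  define f where "f = sing_factor q"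
  define I where "I = pair_integral x P"
  define l where "l = li2 (2 + real P)"
  have f: "f = 1 + 1 / (real q - 2)" unfolding f_def using q_gt_2 by (rule sing_factor_eq)
  have f1: "f > 1" unfolding f_def using q_gt_2 by (rule sing_factor_gt_1)
  have f2: "f \<le> 2" unfolding f using q_large by (simp add: field_simps)
  have Sd: "singular_series d \<le> S / f"
    using singular_series_less_primorial[OF prime_q q_gt_2 d] f1 by (simp add: f_def le_divide_eq)
  have Id: "pair_integral x d \<le> I + l"
    using pair_integral_diff_le[of x P d] P_le_x x_pos unfolding I_def l_def by linarith
  have "singular_series d * pair_integral x d \<le> S / f * (I + l)"
    using Sd Id S_pos f1 pair_integral_nonneg singular_series_nonneg by (intro mult_mono) auto
  then have 1: "S * I - singular_series d * pair_integral x d \<ge> S / f * ((f - 1) * I - l)"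
    using f1 by (simp add: field_simps)
  have "l \<le> li2 (2 + (1 - \<delta> / 2) * (x / ln x))" unfolding l_def scaled(2) using P by (intro li2_mono) simp
  also have "\<dots> \<le> (1 - 16 * \<eta>) * (U / L)" using li2_start unfolding scaled(3) by (simp add: \<eta>_def)
  finally have l: "l \<le> (1 - 16 * \<eta>) * (U / L)" .
  have "f - 1 \<ge> (1 - \<eta>) / L"
  proof -
    have "(1 - \<eta>) / L \<le> 1 / ((1 + \<eta>) * L)"
    proof -
      have "(1 - \<eta>) * (1 + \<eta>) \<le> 1" by (simp add: algebra_simps)
      then have "1 - \<eta> \<le> 1 / (1 + \<eta>)" using \<eta> by (simp add: le_divide_eq)
      then have "(1 - \<eta>) / L \<le> 1 / (1 + \<eta>) / L" using L_large by (intro divide_right_mono) auto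
      then show ?thesis by simp
    qed
    also have "\<dots> \<le> 1 / (real q - 2)"
      using q_bounds q_large by (intro divide_left_mono mult_pos_pos) (use \<eta> L_large in auto)
    finally show ?thesis by (simp add: f)
  qed
  then have "(1 - \<eta>) / L * ((1 - \<eta>) * U) \<le> (f - 1) * I"
    using integral_P_ge f1 \<eta> U_pos L_large unfolding I_def by (intro mult_mono) auto
  then have "(1 - \<eta>) * (1 - \<eta>) * (U / L) \<le> (f - 1) * I" by simp
  moreover have "(1 - 2 * \<eta>) * (U / L) \<le> (1 - \<eta>) * (1 - \<eta>) * (U / L)"
    using U_pos L_large by (intro mult_right_mono) (auto simp: algebra_simps)
  \<comment> \<open>Of the 16 units of slack, two are spent on the estimates for
    \<open>f - 1\<close> and the integral; 14 remain.\<close>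
  moreover have "(1 - 2 * \<eta>) * V - (1 - 16 * \<eta>) * V = 14 * (\<eta> * V)" for V :: real
    by (simp add: algebra_simps)
  moreover have "w \<le> Y - Z" if "A \<le> Y" "B \<le> A" "B - C = 14 * v" "Z \<le> C" "15 * w \<le> v" "w \<ge> 0"
    for A B C Y Z v w :: real
    using that by linarith
  moreover have "U / L\<^sup>2 \<ge> 0" using U_pos by simp
  ultimately have "(f - 1) * I - l \<ge> U / L\<^sup>2" using l lower_order by blast
  moreover have "U / L\<^sup>2 > 0" using U_pos L_large by simp
  ultimately have "S / 2 * (U / L\<^sup>2) \<le> S / f * ((f - 1) * I - l)"
    using S_pos f1 f2 by (intro mult_mono divide_left_mono) auto
  moreover have "S * (U / L\<^sup>2 / 8) \<le> S / 2 * (U / L\<^sup>2)"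
    using mult_pos_pos[OF S_pos \<open>U / L\<^sup>2 > 0\<close>] by simp
  ultimately show "S * pair_integral x P - singular_series d * pair_integral x d \<ge> S * (U / L\<^sup>2 / 8)"
    using 1 unfolding I_def by linarith
qed fact

text \<open>Below the next primorial the singular series cannot exceed \<open>S\<close>. A proper
  multiple of \<open>P\<close> has d - P at least P, about U, and loses through the integral; a
  non-multiple loses a relative 1 / q'^2, of order 1 / L^2, through the singular series. Either loss
  has order U / L^2.\<close>

lemma between_loses:
  assumes d: "P < d" "d < q' * P" "real d \<le> x / 2"
  shows "prime_pair_count x d < prime_pair_count x P"
proof (rule count_less)
  show "d > 0" using d by simp
  show "real d \<le> 8 / 9 * x" using d x_pos by linarith
  have U2: "U / L\<^sup>2 > 0" using U_pos L_large by simp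
  have "2 \<le> x - real d" using d P_le_x x_pos by linarith
  then have Idiff: "pair_integral x P - pair_integral x d \<ge> (real d - real P) / L\<^sup>2"
    using pair_integral_diff_ge[of P d x] d by (simp add: L_def)
  moreover have "(real d - real P) / L\<^sup>2 \<ge> 0" using d by simp
  ultimately have Ile: "pair_integral x d \<le> pair_integral x P" by linarith
  show "S * (U / L\<^sup>2 / 8) \<le> S * pair_integral x P - singular_series d * pair_integral x d"
  proof (cases "P dvd d")
    case True
    then obtain k where k: "d = P * k" by blast
    then have "k \<ge> 2" using d by (cases k; cases "k - 1") auto
    then have "d \<ge> P * 2" unfolding k by (intro mult_left_mono) auto
    then have "real d - real P \<ge> 3 / 4 * U" using P_bounds by linarith
    then have "(real d - real P) / L\<^sup>2 \<ge> 3 / 4 * U / L\<^sup>2" by (intro divide_right_mono) auto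
    then have "pair_integral x P - pair_integral x d \<ge> U / L\<^sup>2 / 8" using Idiff U2 by simp
    then have "S * (U / L\<^sup>2 / 8) \<le> S * (pair_integral x P - pair_integral x d)"
      using S_pos by (intro mult_left_mono) auto
    moreover have "singular_series d * pair_integral x d \<le> S * pair_integral x d"
      using singular_series_less_next_primorial[OF prime_q, of d] d pair_integral_nonneg
      by (intro mult_right_mono) auto
    ultimately show ?thesis by (simp add: right_diff_distrib)
  next
    case False
    have q'2: "(real q')\<^sup>2 \<le> 2 * L\<^sup>2"
    proof -
      have "(real q')\<^sup>2 \<le> ((1 + \<eta>) * L)\<^sup>2" using q_bounds by (intro power_mono) auto
      also have "\<dots> = (1 + \<eta>)\<^sup>2 * L\<^sup>2" by (simp add: power_mult_distrib)
      also have "(1 + \<eta>)\<^sup>2 \<le> (1 + 1 / 256)\<^sup>2" using \<eta> by (intro power_mono) auto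
      also have "\<dots> \<le> (2 :: real)" by (simp add: power2_eq_square)
      finally show ?thesis by (simp add: mult_right_mono)
    qed
    have q'pos: "(real q')\<^sup>2 \<ge> 1" using q_large q_bounds by simp
    then have "1 / (real q')\<^sup>2 \<le> 1" by (subst divide_le_eq_1_pos) linarith+
    then have fac: "1 - 1 / (real q')\<^sup>2 \<ge> 0" by simp
    have "singular_series d * pair_integral x d \<le> S * (1 - 1 / (real q')\<^sup>2) * pair_integral x P"
      using singular_series_non_multiple[OF prime_q q_gt_2 _ _ False] d Ile pair_integral_nonneg S_pos fac
      by (intro mult_mono) auto
    then have "S * pair_integral x P - singular_series d * pair_integral x d \<ge> S * (pair_integral x P / (real q')\<^sup>2)"
      by (simp add: algebra_simps)
    moreover have "U / L\<^sup>2 / 8 \<le> pair_integral x P / (real q')\<^sup>2"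
    proof -
      have "U / L\<^sup>2 / 8 \<le> (1 / 2 * U) / (2 * L\<^sup>2)" using U2 by simp
      also have "\<dots> \<le> (1 / 2 * U) / (real q')\<^sup>2"
        using q'2 q'pos U_pos L_large by (intro divide_left_mono mult_pos_pos) (linarith | simp)+
      also have "\<dots> \<le> pair_integral x P / (real q')\<^sup>2"
      proof (intro divide_right_mono)
        have "1 / 2 * U \<le> (1 - \<eta>) * U" using \<eta> U_pos by (intro mult_right_mono) auto
        then show "1 / 2 * U \<le> pair_integral x P" using integral_P_ge by linarith
      qed auto
      finally show ?thesis .
    qed
    then have "S * (U / L\<^sup>2 / 8) \<le> S * (pair_integral x P / (real q')\<^sup>2)"
      using S_pos by (intro mult_left_mono) auto
    ultimately show ?thesis by linarith
  qed
qed

text \<open>At most one further prime can be gained, worth \<open>g * I\<close>, about U / L, while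
  the integral loses \<open>X\<close>. The hypothesis on the next primorial makes \<open>X\<close>
  larger by a relative margin of about 12 \<open>\<eta>\<close>.\<close>

lemma beyond_next_loses:
  assumes Q: "real (q' * P) \<ge> (1 + \<delta> / 4) * (U * L)"
    and d: "q' * P \<le> d" "real d \<le> x / 2"
  shows "prime_pair_count x d < prime_pair_count x P"
proof (rule count_less)
  have q'1: "q' > 1" using q_gt_2 q_bounds by linarith
  then have "1 * P \<le> q' * P" by (intro mult_right_mono) auto
  then have Pd: "P \<le> d" using d(1) by linarith
  show d0: "d > 0" using Pd primorial_upto_pos[of q] by linarith
  show "real d \<le> 8 / 9 * x" using d x_pos by linarith
  define g where "g = sing_factor q' - 1"
  define I where "I = pair_integral x P"
  define X where "X = (real d - real P) / L\<^sup>2"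
  have g: "g = 1 / (real q' - 2)" unfolding g_def using q_gt_2 q_bounds by (subst sing_factor_eq) auto
  have g0: "g > 0" unfolding g using q_large q_bounds by simp
  \<comment> \<open>The primorial after the next one exceeds x, so the singular series at
    \<open>d\<close> is bounded by its value at \<open>q' * P\<close>.\<close>
  have d_less: "d < next_prime q' * primorial_upto q'"
  proof -
    have "(1 - \<eta>) * L * ((1 + \<delta> / 4) * (U * L)) \<le> real (next_prime q') * real (q' * P)"
      using Q \<eta> L_large U_pos q_large next_prime(2)[of q'] by (intro mult_mono) auto
    also have "(1 - \<eta>) * L * ((1 + \<delta> / 4) * (U * L)) = (1 - \<eta>) * (1 + \<delta> / 4) * (U * L\<^sup>2)"
      by (simp add: power2_eq_square)
    also have "\<dots> = (1 - \<eta>) * (1 + 16 * \<eta>) * x"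
      by (simp only: x_eq[symmetric] quarter_\<delta>)
    also have "(1 - \<eta>) * (1 + 16 * \<eta>) = 1 + \<eta> * (15 - 16 * \<eta>)" by (simp add: algebra_simps)
    finally have "x * (1 + \<eta> * (15 - 16 * \<eta>)) \<le> real (next_prime q') * real (q' * P)" by (simp add: mult.commute)
    moreover have "x * 1 \<le> x * (1 + \<eta> * (15 - 16 * \<eta>))" using x_pos \<eta> by (intro mult_left_mono) auto
    ultimately have "real d < real (next_prime q' * (q' * P))" using d x_pos unfolding of_nat_mult by linarith
    then show ?thesis unfolding primorial_upto_next by (simp only: of_nat_less_iff)
  qed
  have Sd: "singular_series d \<le> S * (1 + g)"
    using singular_series_less_next_primorial[OF next_prime(1) d0 d_less]
      singular_series_primorial_next[OF prime_q] by (simp add: g_def)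
  have "2 \<le> x - real d" using d P_le_x x_pos by linarith
  then have Id: "pair_integral x d \<le> I - X"
    using pair_integral_diff_ge[of P d x] Pd by (simp add: L_def I_def X_def)
  have "singular_series d * pair_integral x d \<le> S * (1 + g) * (I - X)"
    using Sd Id S_pos g0 pair_integral_nonneg singular_series_nonneg by (intro mult_mono) auto
  then have 1: "S * I - singular_series d * pair_integral x d \<ge> S * (X + g * X - g * I)"
    by (simp add: algebra_simps)
  have X: "X \<ge> (1 + 16 * \<eta>) * (1 - \<eta>) * (U / L)"
  proof -
    \<comment> \<open>Thus \<open>P\<close> is at most the fraction \<open>\<eta>\<close> of the
      next primorial, and subtracting it costs one unit of slack.\<close>
    have "real q' * \<eta> \<ge> 1"
    proof -
      have "L * \<eta> * (1 - \<eta>) \<ge> 15 * (1 - 1 / 256)" using \<eta>L \<eta> by (intro mult_mono) (auto simp: mult.commute)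
      moreover have "real q' * \<eta> \<ge> (1 - \<eta>) * L * \<eta>" using q_large \<eta> by (intro mult_right_mono) auto
      moreover have "(1 - \<eta>) * L * \<eta> = L * \<eta> * (1 - \<eta>)" by simp
      moreover have "15 * (1 - 1 / 256) \<ge> (1 :: real)" by simp
      ultimately show ?thesis by linarith
    qed
    then have "1 * real P \<le> real q' * \<eta> * real P" by (intro mult_right_mono) auto
    then have "real d - real P \<ge> real (q' * P) * (1 - \<eta>)" using d by (simp add: algebra_simps flip: of_nat_mult)
    moreover have "(1 + \<delta> / 4) * (U * L) * (1 - \<eta>) \<le> real (q' * P) * (1 - \<eta>)"
      using Q \<eta> by (intro mult_right_mono) auto
    ultimately have "(1 + 16 * \<eta>) * (U * L) * (1 - \<eta>) \<le> real d - real P" by (simp only: quarter_\<delta>)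
    then have "(1 + 16 * \<eta>) * (U * L) * (1 - \<eta>) / L\<^sup>2 \<le> X" unfolding X_def by (intro divide_right_mono) auto
    then show ?thesis using L_large by (simp add: power2_eq_square mult_ac)
  qed
  then have "X \<ge> 0" using \<eta> U_pos L_large by (intro order_trans[OF _ X]) auto
  then have "g * X \<ge> 0" using g0 by simp
  have "g \<le> (1 + 2 * \<eta>) / L"
  proof -
    have "(1 - \<eta>) * L - 2 > 0" using q_large L_large \<eta> mult_mono[of "1 / 2" "1 - \<eta>" 3840 L] by auto
    moreover have "(1 + 2 * \<eta>) * ((1 - \<eta>) * L - 2) \<ge> L"
    proof -
      have "\<eta> * L * (1 - 2 * \<eta>) \<ge> 15 * (1 / 2)" using \<eta>L \<eta> by (intro mult_mono) auto
      then show ?thesis using \<eta> by (simp add: algebra_simps)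
    qed
    ultimately have "1 / ((1 - \<eta>) * L - 2) \<le> (1 + 2 * \<eta>) / L" using L_large by (simp add: field_simps)
    moreover have "g \<le> 1 / ((1 - \<eta>) * L - 2)" unfolding g
      using q_large \<open>(1 - \<eta>) * L - 2 > 0\<close> by (intro divide_left_mono) auto
    ultimately show ?thesis by linarith
  qed
  moreover have "I \<le> (1 + \<eta>) * U"
    using pair_integral_le_li2[of x P] li2_mono[of "x - real P" x] li2_full unfolding scaled(1) I_def \<eta>_def by linarith
  ultimately have "g * I \<le> (1 + 2 * \<eta>) / L * ((1 + \<eta>) * U)"
    using \<eta> L_large pair_integral_nonneg unfolding I_def by (intro mult_mono) auto
  then have "g * I \<le> (1 + 2 * \<eta>) * (1 + \<eta>) * (U / L)" by simp
  then have "X + g * X - g * I \<ge> (1 + 16 * \<eta>) * (1 - \<eta>) * (U / L) - (1 + 2 * \<eta>) * (1 + \<eta>) * (U / L)"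
    using X \<open>g * X \<ge> 0\<close> by linarith
  also have "(1 + 16 * \<eta>) * (1 - \<eta>) * (U / L) - (1 + 2 * \<eta>) * (1 + \<eta>) * (U / L) = (12 - 18 * \<eta>) * (\<eta> * (U / L))"
    by (simp add: algebra_simps diff_divide_distrib add_divide_distrib)
  also have "(12 - 18 * \<eta>) * (\<eta> * (U / L)) \<ge> 1 * (\<eta> * (U / L))"
    using \<eta> U_pos L_large by (intro mult_right_mono) auto
  finally have "X + g * X - g * I \<ge> \<eta> * (U / L)" by simp
  moreover have "U / L\<^sup>2 > 0" using U_pos L_large by simp
  moreover have "w / 8 \<le> Z" if "v \<le> Z" "w > 0" "15 * w \<le> v" for v w Z :: real using that by linarith
  ultimately have "X + g * X - g * I \<ge> U / L\<^sup>2 / 8" using lower_order by blast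
  then have "S * (X + g * X - g * I) \<ge> S * (U / L\<^sup>2 / 8)" using S_pos by (intro mult_left_mono) auto
  then show "S * (U / L\<^sup>2 / 8) \<le> S * pair_integral x P - singular_series d * pair_integral x d"
    using 1 unfolding I_def by linarith
qed

text \<open>The integral has dropped to at most 3 / 5 U, and prime factors beyond \<open>q\<close>
  raise the singular series by at most 11 / 10. The product 0.66 stays clear of the 9 / 10 U
  available at \<open>P\<close>, so fixed constants suffice here.\<close>

lemma far_loses:
  assumes d: "real d \<ge> x / 2"
  shows "prime_pair_count x d < prime_pair_count x P"
proof -
  define w where "w = U / L\<^sup>2"
  have w: "w > 0" "w \<le> U"
  proof -
    show "w > 0" using U_pos L_large by (simp add: w_def)
    have "L\<^sup>2 \<ge> 1" using L_large by simp
    then show "w \<le> U" unfolding w_def using U_pos by (simp add: divide_le_eq)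
  qed
  have d0: "d > 0" using d x_pos by (intro gr0I) simp
  have P1: "S * (9 / 10 * U) \<le> S * pair_integral x P"
  proof (rule mult_left_mono)
    have "9 / 10 * U \<le> (1 - \<eta>) * U" using \<eta> U_pos by (intro mult_right_mono) auto
    then show "9 / 10 * U \<le> pair_integral x P" using integral_P_ge by linarith
  qed (use S_pos in simp)
  have SU: "S * U \<ge> 2 * twin_prime_const * w"
    using S_ge S_pos w twin_prime_const_pos by (intro mult_mono) auto
  have Cw: "twin_prime_const * w > 0" using twin_prime_const_pos w by simp
  have "real (prime_pair_count x d) < real (prime_pair_count x P)"
  proof (cases "real d \<le> x")
    case False
    then show ?thesis using prime_pair_count_eq_0[of x d] count_P_ge P1 SU Cw by (simp flip: w_def)
  next
    case True
    have "singular_series d \<le> S * exp (ln x / (ln (real q) * (real q - 2)))"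
      using singular_series_le_exp[OF prime_q _ d0 True] q_large by simp
    also have "exp (ln x / (ln (real q) * (real q - 2))) \<le> 11 / 10"
    proof -
      have y: "(1 - \<eta>) * L > 2"
        using mult_mono[of "1 / 2" "1 - \<eta>" 3840 L] \<eta> L_large by auto
      have "ln ((1 - \<eta>) * L) \<le> ln (real q)" using q_bounds y by (subst ln_le_cancel_iff) auto
      moreover have "ln ((1 - \<eta>) * L) > 0" using y by simp
      ultimately have "ln x / (ln (real q) * (real q - 2)) \<le> ln x / (ln ((1 - \<eta>) * L) * ((1 - \<eta>) * L - 2))"
        using q_bounds y L_large by (intro divide_left_mono mult_mono mult_pos_pos) (auto simp: L_def)
      then show ?thesis using exp_small unfolding \<eta>_def L_def by (meson exp_le_cancel_iff order_trans)
    qed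
    finally have Sd: "singular_series d \<le> S * (11 / 10)" using S_pos by simp
    have li: "singular_series d * li2 (x / 2) \<le> S * (11 / 10) * (3 / 5 * U)"
      using Sd li2_half li2_nonneg S_pos unfolding scaled(1) by (intro mult_mono) auto
    have "real (prime_pair_count x d) \<le> singular_series d * li2 (x / 2) + twin_prime_const / 8 * w"
    proof (cases "real d \<le> 8 / 9 * x")
      case False
      then show ?thesis using hl_beyond[of d] True by (simp add: scaled(4) w_def)
    next
      case True
      have "2 \<le> d" using d P_le_x by linarith
      from hl[OF this True] have "real (prime_pair_count x d) \<le>
          singular_series d * pair_integral x d + twin_prime_const / 16 * w"
        unfolding scaled(4) w_def by linarith
      moreover have "pair_integral x d \<le> li2 (x / 2)"
        using pair_integral_le_li2[of x d] li2_mono[of "x - real d" "x / 2"] d by linarith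
      then have "singular_series d * pair_integral x d \<le> singular_series d * li2 (x / 2)"
        by (intro mult_left_mono singular_series_nonneg)
      ultimately show ?thesis using Cw by simp
    qed
    then show ?thesis using li count_P_ge P1 SU Cw by (simp flip: w_def)
  qed
  then show ?thesis by simp
qed

end

text \<open>Each endpoint of the interval has its own use: the upper bound on the primorial defeats
  everything smaller, and the lower bound, multiplied by a prime near \<open>L\<close>, pushes the
  next primorial past (1 + \<open>\<delta>\<close> / 4) U L.\<close>

lemma champions_single:
  assumes q: "prime q" and P: "(1 + \<delta> / 2) * (x / (ln x)\<^sup>2) \<le> real (primorial_upto q)"
    "real (primorial_upto q) \<le> (1 - \<delta> / 2) * (x / ln x)"
  shows "prime_difference_champions x = {primorial_upto q}"
proof -
  let ?P = "primorial_upto q"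
  note P = P[unfolded scaled]
  have "(1 - \<delta>) * U \<le> (1 + \<delta> / 2) * U" "(1 - \<delta> / 2) * (U * L) \<le> (1 + \<delta>) * (U * L)"
    using \<delta> U_pos L_large by (auto intro!: mult_right_mono)
  then have range: "in_range q" using q P by (simp add: in_range_def)
  have Q: "real (next_prime q * ?P) \<ge> (1 + \<delta> / 4) * (U * L)"
  proof -
    have 1: "(1 - \<eta>) * L * ((1 + \<delta> / 2) * U) \<le> real (next_prime q) * real ?P"
      using q_large(2)[OF range] P \<delta> U_pos L_large \<eta> by (intro mult_mono) auto
    have "\<delta> * \<eta> \<le> \<delta> * (1 / 256)" using \<delta> \<eta> by (intro mult_left_mono) auto
    moreover have "(1 - \<eta>) * (1 + \<delta> / 2) = 1 + \<delta> / 2 - \<eta> - \<delta> * \<eta> / 2" by (simp add: field_simps)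
    ultimately have "1 + \<delta> / 4 \<le> (1 - \<eta>) * (1 + \<delta> / 2)" using \<eta> by linarith
    then have "(1 + \<delta> / 4) * (U * L) \<le> (1 - \<eta>) * (1 + \<delta> / 2) * (U * L)"
      using U_pos L_large by (intro mult_right_mono) auto
    with 1 show ?thesis by (simp add: mult_ac)
  qed
  have loses: "prime_pair_count x d < prime_pair_count x ?P" if pos: "d > 0" and ne: "d \<noteq> ?P" for d
  proof -
    consider "d < ?P" | "?P < d" "d < next_prime q * ?P" "real d \<le> x / 2"
      | "next_prime q * ?P \<le> d" "real d \<le> x / 2" | "real d \<ge> x / 2" by atomize_elim (use ne in linarith)
    then show ?thesis
    proof cases
      case 1
      then show ?thesis by (rule below_loses[OF range P(2) pos])
    next
      case 2
      then show ?thesis by (rule between_loses[OF range])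
    next
      case 3
      then show ?thesis by (rule beyond_next_loses[OF range Q])
    next
      case 4
      then show ?thesis by (rule far_loses[OF range])
    qed
  qed
  have "prime_pair_count x d \<le> prime_pair_count x ?P" if "d > 0" for d
    by (cases "d = ?P") (use loses[OF that] in auto)
  then have "?P \<in> prime_difference_champions x"
    using primorial_upto_pos[of q] by (simp add: prime_difference_champions_def)
  moreover have "d = ?P" if "d \<in> prime_difference_champions x" for d
  proof (rule ccontr)
    assume "d \<noteq> ?P"
    then have "prime_pair_count x d < prime_pair_count x ?P"
      using that loses[of d] by (simp add: prime_difference_champions_def)
    moreover have "prime_pair_count x ?P \<le> prime_pair_count x d"
      using that primorial_upto_pos[of q] by (simp add: prime_difference_champions_def)
    ultimately show False by simp
  qed
  ultimately show ?thesis by blast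
qed

text \<open>Take the last primorial below the interval and its successor, which must lie above the
  interval. Their ratio is a prime within a factor 1 \<open>\<plusminus>\<close>
  \<open>\<eta>\<close> of \<open>L\<close>, so the location of either one confines the
  other.\<close>

lemma champions_pair:
  assumes none: "\<nexists>P. is_primorial P \<and>
    real P \<in> {(1 + \<delta> / 2) * (x / (ln x)\<^sup>2) .. (1 - \<delta> / 2) * (x / ln x)}"
  shows "\<exists>P Q. is_primorial P \<and>
            real P \<in> {(1 - \<delta>) * (x / (ln x)\<^sup>2) ..< (1 + \<delta> / 2) * (x / (ln x)\<^sup>2)} \<and>
            is_primorial Q \<and>
            real Q \<in> {(1 - \<delta> / 2) * (x / ln x) <.. (1 + \<delta>) * (x / ln x)} \<and>
            (prime_difference_champions x = {P} \<or>
             prime_difference_champions x = {Q} \<or>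
             prime_difference_champions x = {P, Q})"
proof -
  \<comment> \<open>The maximal element of this finite set is the largest prime factor of the
    smaller competitor; the set contains 2 because U > 2.\<close>
  define A where "A = {q. prime q \<and> real (primorial_upto q) < (1 + \<delta> / 2) * U}"
  have U2: "U > 2"
  proof -
    have "L\<^sup>2 \<ge> 1" using L_large by simp
    then have "U / L\<^sup>2 \<le> U" using U_pos by (simp add: divide_le_eq)
    moreover have "U / L\<^sup>2 > 2"
    proof -
      have w: "U / L\<^sup>2 > 0" using U_pos L_large by simp
      have "twin_prime_const \<le> 1" using twin_prime_const_le[of 0] by (simp add: twin_factor_def)
      then have "twin_prime_const * (U / L\<^sup>2) \<le> 1 * (U / L\<^sup>2)" using w by (intro mult_right_mono) auto
      then show ?thesis using x_large unfolding scaled(4) by linarith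
    qed
    ultimately show ?thesis by linarith
  qed
  have "finite A"
  proof (rule finite_subset)
    have "q \<le> primorial_upto q" if "prime q" for q
    proof -
      have "q * \<Prod>(primes_below q) \<ge> q * 1"
        by (intro mult_left_mono) (auto simp: primes_below_def Suc_le_eq prime_gt_0_nat intro!: prod_pos)
      then show ?thesis using primorial_upto_prime[OF that] by simp
    qed
    then show "A \<subseteq> {q. real q \<le> (1 + \<delta> / 2) * U \<and> True}" unfolding A_def
      by (auto intro: order_trans less_imp_le) (meson le_less_trans less_imp_le of_nat_le_iff)
  qed (rule finite_nat_real_le)
  have "primorial_upto 2 = 2"
  proof -
    have "{p. prime p \<and> p \<le> (2 :: nat)} = {2}" by (auto dest: prime_ge_2_nat)
    then show ?thesis by (simp add: primorial_upto_def)
  qed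
  moreover have "1 * U \<le> (1 + \<delta> / 2) * U" using \<delta> U2 by (intro mult_right_mono) auto
  ultimately have "real (primorial_upto 2) < (1 + \<delta> / 2) * U" using U2 by linarith
  then have "2 \<in> A" unfolding A_def by simp
  define q where "q = Max A"
  have qA: "q \<in> A" unfolding q_def using \<open>finite A\<close> \<open>2 \<in> A\<close> by (intro Max_in) auto
  let ?r = "next_prime q"
  let ?P = "primorial_upto q" and ?Q = "primorial_upto ?r"
  have q: "prime q" "real ?P < (1 + \<delta> / 2) * U" using qA by (auto simp: A_def)
  have r: "prime ?r" "q < ?r" by (rule next_prime)+
  have "?r \<notin> A" using Max_ge[OF \<open>finite A\<close>, of ?r] r(2) by (auto simp flip: q_def)
  then have "real ?Q \<ge> (1 + \<delta> / 2) * U" using r by (simp add: A_def)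
  have Q: "real ?Q > (1 - \<delta> / 2) * (U * L)"
  proof -
    have "\<not> (\<exists>q. prime q \<and> ?Q = primorial_upto q) \<or>
        \<not> real ?Q \<in> {(1 + \<delta> / 2) * U..(1 - \<delta> / 2) * (U * L)}"
      using none unfolding is_primorial_iff scaled by blast
    then show ?thesis using r(1) \<open>real ?Q \<ge> (1 + \<delta> / 2) * U\<close> by auto
  qed
  have QP: "real ?Q = real ?r * real ?P" by (simp add: primorial_upto_next)
  have U_UL: "2 * U \<le> 1 / 2 * (U * L)" using U_pos L_large by simp
  have "1 / 2 * (U * L) \<le> (1 - \<delta> / 2) * (U * L)" using \<delta> U_pos L_large by (intro mult_right_mono) auto
  then have Q': "real ?Q \<ge> 1 / 2 * (U * L)" using Q by linarith
  have "(1 + \<delta> / 2) * U \<le> 2 * U" using \<delta> U_pos by (intro mult_right_mono) auto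
  then have P_small: "real ?P \<le> 1 / 2 * (U * L)" using q U_UL by linarith
  have "U * L \<le> U * L\<^sup>2" using U_pos L_large by (simp add: power2_eq_square)
  then have UL: "U * L \<le> x" using x_eq by linarith
  have qr: "(1 - \<eta>) * L \<le> real q" "real ?r \<le> (1 + \<eta>) * L"
  proof -
    have "x / (ln x)\<^sup>2 \<le> real ?Q" unfolding scaled(1) using Q' U_UL U_pos by linarith
    moreover have "real ?P \<le> 2 * x" using P_small UL x_pos by linarith
    ultimately show "(1 - \<eta>) * L \<le> real q" "real ?r \<le> (1 + \<eta>) * L"
      using primes[OF q(1)] by (auto simp: L_def \<eta>_def)
  qed
  have P_ge: "real ?P \<ge> (1 - \<delta>) * U"
  proof -
    have "(1 - \<delta> / 2) * (U * L) < (1 + \<eta>) * L * real ?P"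
    proof -
      have "real ?r * real ?P \<le> (1 + \<eta>) * L * real ?P" using qr by (intro mult_right_mono) auto
      then show ?thesis using Q QP by linarith
    qed
    moreover have "\<delta> * \<eta> \<ge> 0" using \<delta> \<eta> by simp
    then have "(1 + \<eta>) * (1 - \<delta>) \<le> 1 - \<delta> / 2" using \<delta> unfolding \<eta>_def by (simp add: algebra_simps)
    then have "(1 + \<eta>) * (1 - \<delta>) * (U * L) \<le> (1 - \<delta> / 2) * (U * L)"
      using U_pos L_large by (intro mult_right_mono) auto
    ultimately have "((1 + \<eta>) * L) * ((1 - \<delta>) * U) < ((1 + \<eta>) * L) * real ?P" by (simp add: mult_ac)
    then show ?thesis using \<eta> L_large by (subst (asm) mult_less_cancel_left_pos) auto
  qed
  have Q_le: "real ?Q \<le> (1 + \<delta>) * (U * L)"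
  proof -
    have "real ?Q \<le> (1 + \<eta>) * L * ((1 + \<delta> / 2) * U)"
      unfolding QP using qr q \<eta> L_large by (intro mult_mono) auto
    moreover have \<delta>\<eta>: "\<delta> * \<eta> \<le> \<delta> * (1 / 256)" using \<delta> \<eta> by (intro mult_left_mono) auto
    have "(1 + \<eta>) * (1 + \<delta> / 2) = 1 + \<delta> / 2 + \<eta> + \<delta> * \<eta> / 2" by (simp add: field_simps)
    then have "(1 + \<eta>) * (1 + \<delta> / 2) \<le> 1 + \<delta>" using \<delta>\<eta> \<eta> by linarith
    then have "(1 + \<eta>) * (1 + \<delta> / 2) * (U * L) \<le> (1 + \<delta>) * (U * L)"
      using U_pos L_large by (intro mult_right_mono) auto
    ultimately show ?thesis by (simp add: mult_ac)
  qed
  have "(1 + \<delta> / 2) * U \<le> (1 - \<delta> / 2) * (U * L)" 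
    using \<open>(1 + \<delta> / 2) * U \<le> 2 * U\<close> U_UL \<open>1 / 2 * (U * L) \<le> (1 - \<delta> / 2) * (U * L)\<close> by linarith
  then have P_le: "real ?P \<le> (1 - \<delta> / 2) * (U * L)" using q by linarith
  have "(1 - \<delta> / 2) * (U * L) \<le> (1 + \<delta>) * (U * L)" using \<delta> U_pos L_large by (intro mult_right_mono) auto
  then have rangeP: "in_range q" using P_le P_ge q by (simp add: in_range_def)
  have "(1 - \<delta>) * U \<le> real ?Q"
  proof -
    have "1 * real ?P \<le> real ?r * real ?P" using r by (intro mult_right_mono) (auto simp: prime_ge_1_nat Suc_le_eq)
    then show ?thesis using P_ge QP by linarith
  qed
  then have rangeQ: "in_range ?r" using Q_le r by (simp add: in_range_def)
  \<comment> \<open>The primorial after \<open>?Q\<close> is already beyond x / 2, so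
    \<open>?Q\<close> beats everything between itself and x / 2 by
    \<open>between_loses\<close>.\<close>
  have far: "x / 2 \<le> real (next_prime ?r * ?Q)"
  proof -
    have "((1 - \<eta>) * L) * ((1 - \<delta> / 2) * (U * L)) \<le> real (next_prime ?r) * real ?Q"
      using q_large(2)[OF rangeQ] Q \<eta> \<delta> L_large U_pos by (intro mult_mono) auto
    moreover have "1 / 2 * x \<le> (1 - \<eta>) * (1 - \<delta> / 2) * x"
    proof (intro mult_right_mono)
      have "(1 - 1 / 256) * (1 - 1 / 8) \<le> (1 - \<eta>) * (1 - \<delta> / 2)" using \<eta> \<delta> by (intro mult_mono) auto
      then show "1 / 2 \<le> (1 - \<eta>) * (1 - \<delta> / 2)" by simp
    qed (use x_pos in simp)
    moreover have "((1 - \<eta>) * L) * ((1 - \<delta> / 2) * (U * L)) = (1 - \<eta>) * (1 - \<delta> / 2) * (U * L\<^sup>2)"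
      by (simp add: power2_eq_square)
    then have "((1 - \<eta>) * L) * ((1 - \<delta> / 2) * (U * L)) = (1 - \<eta>) * (1 - \<delta> / 2) * x"
      by (simp only: x_eq[symmetric])
    ultimately show ?thesis by simp
  qed
  \<comment> \<open>The two primorials are never compared with each other; losing to the maximum
    leaves open which of them wins.\<close>
  have loses: "prime_pair_count x d < max (prime_pair_count x ?P) (prime_pair_count x ?Q)"
    if pos: "d > 0" and ne: "d \<noteq> ?P" "d \<noteq> ?Q" for d
  proof -
    consider "d < ?P" | "?P < d" "d < ?Q" "real d \<le> x / 2"
      | "?Q < d" "real d < x / 2" | "real d \<ge> x / 2" by atomize_elim (use ne in linarith)
    then show ?thesis
    proof cases
      case 1
      then have "prime_pair_count x d < prime_pair_count x ?P" by (rule below_loses[OF rangeP P_le pos])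
      then show ?thesis by simp
    next
      case 2
      then have "prime_pair_count x d < prime_pair_count x ?P"
        by (intro between_loses[OF rangeP]) (auto simp: primorial_upto_next)
      then show ?thesis by simp
    next
      case 3
      then have "real d < real (next_prime ?r * ?Q)" using far by linarith
      then have "d < next_prime ?r * ?Q" by (simp only: of_nat_less_iff)
      then have "prime_pair_count x d < prime_pair_count x ?Q"
        using 3 by (intro between_loses[OF rangeQ]) auto
      then show ?thesis by simp
    next
      case 4
      then have "prime_pair_count x d < prime_pair_count x ?P" by (rule far_loses[OF rangeP])
      then show ?thesis by simp
    qed
  qed
  let ?G = "prime_pair_count x"
  have sub: "d \<in> {?P, ?Q}" if "d \<in> prime_difference_champions x" for d
  proof (rule ccontr)
    assume "d \<notin> {?P, ?Q}"
    then have "?G d < max (?G ?P) (?G ?Q)" using that loses by (simp add: prime_difference_champions_def)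
    moreover have "?G ?P \<le> ?G d" "?G ?Q \<le> ?G d"
      using that primorial_upto_pos by (auto simp: prime_difference_champions_def)
    ultimately show False by simp
  qed
  have max: "?G d \<le> max (?G ?P) (?G ?Q)" if "d > 0" for d
    by (cases "d = ?P \<or> d = ?Q") (use loses[OF that] in auto)
  have P_in: "?P \<in> prime_difference_champions x" if "?G ?Q \<le> ?G ?P"
    using max primorial_upto_pos[of q] unfolding max_absorb1[OF that] by (simp add: prime_difference_champions_def)
  have Q_in: "?Q \<in> prime_difference_champions x" if "?G ?P \<le> ?G ?Q"
    using max primorial_upto_pos[of ?r] unfolding max_absorb2[OF that] by (simp add: prime_difference_champions_def)
  have "prime_difference_champions x \<noteq> {}"
    using P_in Q_in linear[of "?G ?P" "?G ?Q"] by blast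
  then have champions: "prime_difference_champions x = {?P} \<or> prime_difference_champions x = {?Q} \<or>
      prime_difference_champions x = {?P, ?Q}"
    using sub by blast
  have "is_primorial ?P" "is_primorial ?Q" using q(1) r(1) unfolding is_primorial_iff by blast+
  moreover have "real ?P \<in> {(1 - \<delta>) * U..<(1 + \<delta> / 2) * U}" using P_ge q(2) by simp
  moreover have "real ?Q \<in> {(1 - \<delta> / 2) * (U * L)<..(1 + \<delta>) * (U * L)}" using Q Q_le by simp
  ultimately show ?thesis unfolding scaled using champions by blast
qed

end

text \<open>Pair counts increase with the cutoff, and at y = 9 / 8 d the difference is exactly the
  largest admissible one. There y - d = d / 8 is at most x / 2, and y at most 2 x only doubles the
  error bound.\<close>

lemma eventually_hl_beyond:
  assumes HL: hardy_littlewood_hypothesis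
  shows "\<forall>\<^sub>F x in at_top. \<forall>d. 8 / 9 * x < real d \<and> real d \<le> x \<longrightarrow>
    real (prime_pair_count x d) \<le> singular_series d * li2 (x / 2) + twin_prime_const / 8 * (x / ln x ^ 4)"
proof -
  have "\<forall>\<^sub>F x in at_top. \<forall>d. 2 \<le> d \<and> real d \<le> 8 / 9 * x \<longrightarrow>
    \<bar>real (prime_pair_count x d) - singular_series d * pair_integral x d\<bar>
      \<le> twin_prime_const / 16 * (x / (ln x) ^ 4)"
    using twin_prime_const_pos by (intro hardy_littlewood_bound[OF HL]) simp
  then obtain X where X: "\<And>x d. x \<ge> X \<Longrightarrow> 2 \<le> d \<Longrightarrow> real d \<le> 8 / 9 * x \<Longrightarrow>
    \<bar>real (prime_pair_count x d) - singular_series d * pair_integral x d\<bar>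
      \<le> twin_prime_const / 16 * (x / (ln x) ^ 4)"
    unfolding eventually_at_top_linorder by blast
  show ?thesis using eventually_ge_at_top[of X] eventually_gt_at_top[of 3]
  proof eventually_elim
    case (elim x)
    show ?case
    proof (intro allI impI, elim conjE)
      fix d assume d: "8 / 9 * x < real d" "real d \<le> x"
      let ?y = "9 / 8 * real d"
      have y: "x \<le> ?y" "?y \<le> 2 * x" using d elim by linarith+
      have d2: "2 \<le> d" using d elim by linarith
      have "real (prime_pair_count x d) \<le> real (prime_pair_count ?y d)"
        using prime_pair_count_mono[OF y(1)] by simp
      also have "\<dots> \<le> singular_series d * pair_integral ?y d + twin_prime_const / 16 * (?y / ln ?y ^ 4)"
        using X[of ?y d] y elim d2 by simp
      also have "pair_integral ?y d \<le> li2 (x / 2)"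
        using pair_integral_le_li2[of ?y d] li2_mono[of "?y - real d" "x / 2"] d elim by linarith
      also have "?y / ln ?y ^ 4 \<le> 2 * x / ln x ^ 4"
        using y elim by (intro frac_le power_mono) auto
      finally show "real (prime_pair_count x d) \<le>
          singular_series d * li2 (x / 2) + twin_prime_const / 8 * (x / ln x ^ 4)"
        using twin_prime_const_pos singular_series_nonneg[of d] by (simp add: mult_left_mono)
    qed
  qed
qed

lemma eventually_champion_range:
  assumes HL: hardy_littlewood_hypothesis and \<delta>: "0 < \<delta>" "\<delta> \<le> 1 / 4"
  shows "\<forall>\<^sub>F x in at_top. champion_range \<delta> x"
proof -
  have hl: "\<forall>\<^sub>F x in at_top. \<forall>d. 2 \<le> d \<and> real d \<le> 8 / 9 * x \<longrightarrow>
    \<bar>real (prime_pair_count x d) - singular_series d * pair_integral x d\<bar>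
      \<le> twin_prime_const / 16 * (x / (ln x) ^ 4)"
    using twin_prime_const_pos by (intro hardy_littlewood_bound[OF HL]) simp
  have primes: "\<forall>\<^sub>F x in at_top. \<forall>q. prime q \<and> real (primorial_upto q) \<le> 2 * x \<and>
      x / (ln x)\<^sup>2 \<le> real (primorial_upto (next_prime q)) \<longrightarrow>
      (1 - \<delta> / 64) * ln x \<le> real q \<and> real (next_prime q) \<le> (1 + \<delta> / 64) * ln x"
    by (rule eventually_primorial_primes[OF HL]) (use \<delta> in auto)
  have 1: "\<forall>\<^sub>F x in at_top. ln x \<ge> 1000 / \<delta>" by real_asymp
  \<comment> \<open>The exponent behaves like 1 / (c ln ln x), so it tends to 0.\<close>
  have 2: "\<forall>\<^sub>F x in at_top. exp (ln x / (ln ((1 - \<delta> / 64) * ln x) * ((1 - \<delta> / 64) * ln x - 2))) \<le> 11 / 10"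
  proof -
    define c where "c = 1 - \<delta> / 64"
    have c: "c > 0" using \<delta> by (simp add: c_def)
    have "((\<lambda>x. exp (ln x / (ln (c * ln x) * (c * ln x - 2)))) \<longlongrightarrow> 1) at_top"
      using c by real_asymp
    then have "\<forall>\<^sub>F x in at_top. exp (ln x / (ln (c * ln x) * (c * ln x - 2))) < 11 / 10"
      by (rule order_tendstoD) simp
    then show ?thesis unfolding c_def by (rule eventually_mono) simp
  qed
  have 3: "\<forall>\<^sub>F x in at_top. li2 x \<le> (1 + \<delta> / 64) * (x / (ln x)\<^sup>2)"
    using eventually_li2_le[of "\<delta> / 64"] \<delta> by simp
  have 4: "\<forall>\<^sub>F x in at_top. li2 (x / 2) \<le> 3 / 5 * (x / (ln x)\<^sup>2)"
  proof -
    \<comment> \<open>The slack 1 / 10 works because (1 + 1 / 10) / 2 is below 3 / 5.\<close>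
    have "\<forall>\<^sub>F x in at_top. li2 (1 / 2 * x) \<le> (1 + 1 / 10) * (1 / 2 * x) / (ln (1 / 2 * x))\<^sup>2"
      by (rule eventually_at_top_scale[OF eventually_li2_le]) auto
    moreover have "\<forall>\<^sub>F x :: real in at_top. (1 + 1 / 10) * (1 / 2 * x) / (ln (1 / 2 * x))\<^sup>2 \<le> 3 / 5 * (x / (ln x)\<^sup>2)"
      by real_asymp
    ultimately show ?thesis by eventually_elim simp
  qed
  \<comment> \<open>The argument is about c x / ln x, with logarithm asymptotic to
    \<open>ln x\<close>, so \<open>li2\<close> there is about c x / (ln x)^3.\<close>
  have 5: "\<forall>\<^sub>F x in at_top. li2 (2 + (1 - \<delta> / 2) * (x / ln x)) \<le> (1 - \<delta> / 4) * (x / ln x ^ 3)"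
  proof -
    define c where "c = 1 - \<delta> / 2"
    have c: "c > 0" using \<delta> by (simp add: c_def)
    let ?y = "\<lambda>x :: real. 2 + c * (x / ln x)"
    have "filterlim ?y at_top at_top" using c by real_asymp
    then have "\<forall>\<^sub>F x in at_top. li2 (?y x) \<le> (1 + \<delta> / 8) * ?y x / (ln (?y x))\<^sup>2"
      using eventually_li2_le[of "\<delta> / 8"] \<delta> by (auto simp: filterlim_iff)
    moreover have "((\<lambda>x. (?y x / (ln (?y x))\<^sup>2) / (x / ln x ^ 3)) \<longlongrightarrow> c) at_top"
      using c by real_asymp
    then have "((\<lambda>x. (1 + \<delta> / 8) * ((?y x / (ln (?y x))\<^sup>2) / (x / ln x ^ 3))) \<longlongrightarrow> (1 + \<delta> / 8) * c) at_top"
      by (intro tendsto_intros)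
    then have "\<forall>\<^sub>F x in at_top. (1 + \<delta> / 8) * ((?y x / (ln (?y x))\<^sup>2) / (x / ln x ^ 3)) < 1 - \<delta> / 4"
    proof (rule order_tendstoD)
      \<comment> \<open>The slack \<open>\<delta> / 8\<close> granted to \<open>li2\<close> is small
        enough to leave a strict margin between c = 1 - \<open>\<delta>\<close> / 2 and 1 -
        \<open>\<delta>\<close> / 4.\<close>
      have "(1 + \<delta> / 8) * c = 1 - \<delta> * 3 / 8 - \<delta> * \<delta> / 16" by (simp add: c_def field_simps)
      moreover have "\<delta> * \<delta> > 0" using \<delta> by simp
      ultimately show "(1 + \<delta> / 8) * c < 1 - \<delta> / 4" using \<delta> by linarith
    qed
    ultimately show ?thesis using eventually_gt_at_top[of 3]
    proof eventually_elim
      case (elim x)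
      have "ln x ^ 3 > 0" using elim by simp
      then have pos: "x / ln x ^ 3 > 0" using elim by (intro divide_pos_pos) auto
      have "(1 + \<delta> / 8) * ?y x / (ln (?y x))\<^sup>2 / (x / ln x ^ 3) \<le> 1 - \<delta> / 4"
        using elim(2) by (simp only: times_divide_eq_right less_imp_le)
      then have "(1 + \<delta> / 8) * ?y x / (ln (?y x))\<^sup>2 \<le> (1 - \<delta> / 4) * (x / ln x ^ 3)"
        using pos by (simp only: pos_divide_le_eq)
      then show ?case using elim(1) unfolding c_def by linarith
    qed
  qed
  have 6: "\<forall>\<^sub>F x in at_top. (1 + \<delta>) * (x / ln x) + 2 \<le> \<delta> / 64 * x"
    using \<delta> by real_asymp
  have 7: "\<forall>\<^sub>F x in at_top. twin_prime_const * (x / ln x ^ 4) \<ge> 16"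
    using twin_prime_const_pos by real_asymp
  show ?thesis using hl eventually_hl_beyond[OF HL] primes 1 2 3 4 5 6 7
  proof eventually_elim
    case (elim x)
    show ?case
      by unfold_locales (use elim \<delta> in blast)+
  qed
qed

theorem theorem1:
  fixes \<delta> :: real
  assumes "hardy_littlewood_hypothesis"
    and "0 < \<delta>" and "\<delta> \<le> 1 / 4"
  shows "\<forall>\<^sub>F x :: real in at_top.
    (\<forall>P. is_primorial P \<and>
         real P \<in> {(1 + \<delta> / 2) * (x / (ln x)\<^sup>2) .. (1 - \<delta> / 2) * (x / ln x)}
         \<longrightarrow> prime_difference_champions x = {P}) \<and>
    ((\<nexists>P. is_primorial P \<and>
         real P \<in> {(1 + \<delta> / 2) * (x / (ln x)\<^sup>2) .. (1 - \<delta> / 2) * (x / ln x)})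
     \<longrightarrow> (\<exists>P Q. is_primorial P \<and>
            real P \<in> {(1 - \<delta>) * (x / (ln x)\<^sup>2) ..< (1 + \<delta> / 2) * (x / (ln x)\<^sup>2)} \<and>
            is_primorial Q \<and>
            real Q \<in> {(1 - \<delta> / 2) * (x / ln x) <.. (1 + \<delta>) * (x / ln x)} \<and>
            (prime_difference_champions x = {P} \<or>
             prime_difference_champions x = {Q} \<or>
             prime_difference_champions x = {P, Q})))"
  using eventually_champion_range[OF assms]
proof eventually_elim
  case (elim x)
  interpret champion_range \<delta> x by (rule elim)
  show ?case
  proof (intro conjI allI impI, goal_cases)
    case (1 P)
    then show ?case unfolding is_primorial_iff using champions_single by auto
  next
    case 2
    then show ?case by (rule champions_pair)
  qed
qed

end
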